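(* Let $R>0$ and let $g$ be an $R$-path with image contained in an open disk of radius $R$ and with arc length representation $x=x(s)$, $0\le s\le L$. Then there exists a family $(\Omega_s)_{s\in[0,L]}$ of closed subsets of $\mathbb{R}^2$, nested in the sense that $\Omega_{s_1}\subset\Omega_{s_2}$ for $s_1<s_2$, with $\mathrm{reach}(\Omega_s)\ge R$ for every $s$, such that $x(s)\in\partial\Omega_s$ for every $s\in[0,L]$ and $x'(s)\in\mathrm{Nor}(\Omega_s,x(s))$ for almost every $s\in[0,L]$.
   Context: Notation: $B(z,\rho)$ is the open disk in $\mathbb{R}^2$ of center $z$ and radius $\rho$. For a nonempty closed set $K\subset\mathbb{R}^2$ and $q\in K$, the tangent cone is $$\mathrm{Tan}(K,q)=\{v\in\mathbb{R}^2:\forall\varepsilon>0\ \exists x\in K,\ r>0\text{ with }|x-q|<\varepsilon,\ |r(x-q)-v|<\varepsilon\},$$ and the normal cone is $\mathrm{Nor}(K,q)=\{u\in\mathbb{R}^2:\langle u,v\rangle\le0\ \forall v\in\mathrm{Tan}(K,q)\}$. Reach: for a closed set $A$ and $a\in A$, $\mathrm{reach}(A,a)$ is the supremum of all $\rho$ such that every $x\in B(a,\rho)$ has a unique nearest point in $A$; $\mathrm{reach}(A)=\inf_{a\in A}\mathrm{reach}(A,a)$. $R$-path: let $R>0$. A continuous map $g\colon[a,b]\to\mathbb{R}^2$ with $g(a)\ne g(b)$ is an $R$-path if for every $t\in[a,b]$, writing $x=g(t)$, and for every unit vector $l\in\big[-\mathrm{Tan}(g([a,t]),x)\big]\cup\mathrm{Tan}(g([t,b]),x)$,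 one has $g([a,t])\cap B(x+Rl,R)=\varnothing$. *)

theory Defs
  imports "HOL-Analysis.Analysis"
begin

definition tangent_cone :: "(real^2) set \<Rightarrow> real^2 \<Rightarrow> (real^2) set" where
  "tangent_cone K q =
     {v. \<forall>\<epsilon>>0. \<exists>x\<in>K. \<exists>r>0. norm (x - q) < \<epsilon> \<and> norm (r *\<^sub>R (x - q) - v) < \<epsilon>}"

definition normal_cone :: "(real^2) set \<Rightarrow> real^2 \<Rightarrow> (real^2) set" where
  "normal_cone K q = {u. \<forall>v\<in>tangent_cone K q. u \<bullet> v \<le> 0}"

definition is_nearest_point :: "(real^2) set \<Rightarrow> real^2 \<Rightarrow> real^2 \<Rightarrow> bool" where
  "is_nearest_point A x p \<longleftrightarrow> p \<in> A \<and> (\<forall>y\<in>A. dist x p \<le> dist x y)"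

text \<open>The reach may be infinite (e.g. for convex sets), so it takes extended real values.
  The radius \<open>0\<close> is always admissible (the ball is empty), hence \<open>reach_at A a \<ge> 0\<close>.\<close>

definition reach_at :: "(real^2) set \<Rightarrow> real^2 \<Rightarrow> ereal" where
  "reach_at A a =
     Sup {ereal \<rho> | \<rho>. \<rho> \<ge> 0 \<and> (\<forall>x\<in>ball a \<rho>. \<exists>!p. is_nearest_point A x p)}"

definition reach :: "(real^2) set \<Rightarrow> ereal" where
  "reach A = (INF a\<in>A. reach_at A a)"

definition R_path :: "real \<Rightarrow> real \<Rightarrow> real \<Rightarrow> (real \<Rightarrow> real^2) \<Rightarrow> bool" where
  "R_path R a b g \<longleftrightarrow>
     a < b \<and> continuous_on {a..b} g \<and> g a \<noteq> g b \<and>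
     (\<forall>t\<in>{a..b}. \<forall>l \<in> uminus ` tangent_cone (g ` {a..t}) (g t) \<union> tangent_cone (g ` {t..b}) (g t).
        norm l = 1 \<longrightarrow> g ` {a..t} \<inter> ball (g t + R *\<^sub>R l) R = {})"

text \<open>Length of the restriction of \<open>g\<close> to \<open>{a..b}\<close>: supremum of the lengths of the
  inscribed polygonal lines, infinite if \<open>g\<close> is not rectifiable.\<close>

definition curve_length :: "(real \<Rightarrow> real^2) \<Rightarrow> real \<Rightarrow> real \<Rightarrow> ereal" where
  "curve_length g a b =
     Sup {ereal (\<Sum>i<n. dist (g (p i)) (g (p (Suc i)))) | (n::nat) p.
            mono_on {..n} p \<and> p ` {..n} \<subseteq> {a..b}}"

text \<open>\<open>g\<close> has finite length \<open>L\<close> and \<open>g(t) = x(s(t))\<close>, where \<open>s(t)\<close> is the length of \<open>g\<close> on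
  \<open>{a..t}\<close>. For continuous \<open>g\<close>, the function \<open>s\<close> maps \<open>{a..b}\<close> onto \<open>{0..L}\<close>, so this
  determines \<open>x\<close> on \<open>{0..L}\<close>; \<open>g\<close> may be constant on subintervals.\<close>

definition arc_length_representation ::
    "real \<Rightarrow> real \<Rightarrow> (real \<Rightarrow> real^2) \<Rightarrow> real \<Rightarrow> (real \<Rightarrow> real^2) \<Rightarrow> bool" where
  "arc_length_representation a b g L x \<longleftrightarrow>
     curve_length g a b = ereal L \<and>
     (\<forall>t\<in>{a..b}. x (real_of_ereal (curve_length g a t)) = g t)"

end

theory Submission
  imports Defs
begin

text \<open>
  Take for \<open>\<Omega>\<^sub>s\<close> the \<open>R\<close>-hull of the past \<open>A = x([0,s])\<close>: the complement of the union of all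
  open disks of radius \<open>R\<close> missing \<open>A\<close>. A disk of radius \<open>R\<close> missing \<open>A\<close> also misses \<open>\<Omega>\<^sub>s\<close>, so
  the \<open>R\<close>-path condition provides exterior tangent disks of \<open>\<Omega>\<^sub>s\<close> at \<open>x(s)\<close>; these give both the
  frontier and the normal cone statements.

  For the reach, let a point at distance less than \<open>R\<close> have two nearest points \<open>p \<noteq> q\<close> in \<open>\<Omega>\<^sub>s\<close>.
  The intersection of the two closed disks of radius \<open>R\<close> with \<open>p, q\<close> on their boundaries then
  meets \<open>\<Omega>\<^sub>s\<close> only in \<open>p, q\<close>, so the part of the perpendicular bisector of \<open>p, q\<close> inside it is
  covered by open disks of radius \<open>R\<close> missing \<open>A\<close>. Each of them has its centre strictly on one
  side of the line \<open>p q\<close>; the two ends of the part need different sides, so by connectedness a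
  disk centred below the line meets one centred above. The line through both centres separates
  \<open>p\<close> from \<open>q\<close> and does not meet the connected set \<open>A\<close>: a point of \<open>A\<close> on it would lie beyond one
  of the centres, and that centre would be in the triangle it forms with \<open>p\<close> and \<open>q\<close>, at distance
  at least \<open>R\<close> from the three vertices, which therefore fit in no open disk of radius \<open>R\<close>. Hence
  one of \<open>p, q\<close> is not even in the convex hull of \<open>A\<close>.

  The arc length representation is Lipschitz, hence differentiable almost everywhere by Lebesgue's
  theorem, which follows from two applications of the Vitali covering theorem.
\<close>

section \<open>The hull by disks of radius R\<close>

definition R_hull :: "real \<Rightarrow> 'a::metric_space set \<Rightarrow> 'a set" where
  "R_hull R A = {y. \<forall>z. A \<inter> ball z R = {} \<longrightarrow> y \<notin> ball z R}"

lemma subset_R_hull: "A \<subseteq> R_hull R A"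
  by (auto simp: R_hull_def)

lemma R_hull_mono: "A \<subseteq> B \<Longrightarrow> R_hull R A \<subseteq> R_hull R B"
  by (auto simp: R_hull_def)

lemma R_hull_disjoint: "A \<inter> ball z R = {} \<Longrightarrow> R_hull R A \<inter> ball z R = {}"
  by (auto simp: R_hull_def)

lemma closed_R_hull: "closed (R_hull R A)"
proof -
  have "- R_hull R A = (\<Union>z\<in>{z. A \<inter> ball z R = {}}. ball z R)"
    by (auto simp: R_hull_def)
  then show ?thesis
    by (simp add: closed_open open_UN)
qed

text \<open>A point beyond the half-space lies in an open ball of radius \<open>R\<close> that stays
  entirely beyond it.\<close>

lemma R_hull_subset_halfspace:
  fixes n :: "'a::euclidean_space"
  assumes "R > 0" "n \<noteq> 0" "\<And>w. w \<in> A \<Longrightarrow> n \<bullet> w \<le> t" "y \<in> R_hull R A"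
  shows "n \<bullet> y \<le> t"
proof (rule ccontr)
  assume "\<not> n \<bullet> y \<le> t"
  define \<eta> where "\<eta> = (n \<bullet> y - t) / norm n"
  define u where "u = n /\<^sub>R norm n"
  \<comment> \<open>The centre \<open>y + \<mu> *\<^sub>R u\<close> must be at depth at least
    \<open>R\<close>, while \<open>\<mu> < R\<close> keeps \<open>y\<close> in the ball; the
    \<open>min\<close> stops \<mu> from turning negative when \<open>y\<close> is deep.\<close>
  define \<mu> where "\<mu> = R - min \<eta> R"
  have \<eta>: "\<eta> > 0"
    using \<open>\<not> n \<bullet> y \<le> t\<close> \<open>n \<noteq> 0\<close> by (simp add: \<eta>_def)
  have u: "norm u = 1" "u \<bullet> u = 1"
    using \<open>n \<noteq> 0\<close> by (auto simp: u_def dot_square_norm power2_eq_square field_simps)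
  have \<mu>: "0 \<le> \<mu>" "\<mu> < R" "\<eta> + \<mu> \<ge> R"
    using \<eta> \<open>R > 0\<close> by (auto simp: \<mu>_def)
  have "w \<notin> ball (y + \<mu> *\<^sub>R u) R" if "w \<in> A" for w
  proof -
    have "u \<bullet> w = (n \<bullet> w) / norm n" "u \<bullet> y = (n \<bullet> y) / norm n"
      by (auto simp: u_def divide_inverse mult.commute)
    then have "u \<bullet> y - u \<bullet> w \<ge> \<eta>"
      using assms(3)[OF that] \<open>n \<noteq> 0\<close> by (simp add: \<eta>_def diff_divide_distrib divide_right_mono)
    then have "R \<le> u \<bullet> (y + \<mu> *\<^sub>R u - w)"
      using \<mu> u by (simp add: inner_diff_right inner_add_right)
    also have "\<dots> \<le> norm (y + \<mu> *\<^sub>R u - w)"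
      using norm_cauchy_schwarz[of u "y + \<mu> *\<^sub>R u - w"] u by simp
    finally show ?thesis
      by (simp add: dist_norm)
  qed
  then have "A \<inter> ball (y + \<mu> *\<^sub>R u) R = {}"
    by auto
  moreover have "y \<in> ball (y + \<mu> *\<^sub>R u) R"
    using \<mu> u by (simp add: dist_norm)
  ultimately show False
    using assms(4) unfolding R_hull_def by blast
qed

text \<open>To exclude \<open>y\<close>, the half-space with outer normal \<open>y - c\<close> that
  supports the ball suffices. Later this places the hull in an open disk of radius
  \<open>R\<close>.\<close>

lemma R_hull_subset_cball:
  fixes c :: "'a::euclidean_space"
  assumes "0 \<le> r" "0 < R" "A \<subseteq> cball c r"
  shows "R_hull R A \<subseteq> cball c r"
proof
  fix y assume y: "y \<in> R_hull R A"
  show "y \<in> cball c r"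
  proof (cases "y = c")
    case False
    have "(y - c) \<bullet> w \<le> (y - c) \<bullet> c + norm (y - c) * r" if "w \<in> A" for w
    proof -
      have "(y - c) \<bullet> (w - c) \<le> norm (y - c) * norm (w - c)"
        by (rule norm_cauchy_schwarz)
      also have "\<dots> \<le> norm (y - c) * r"
        using that assms(3) by (intro mult_left_mono) (auto simp: dist_norm norm_minus_commute)
      finally show ?thesis
        by (simp add: inner_diff_right)
    qed
    then have "(y - c) \<bullet> y \<le> (y - c) \<bullet> c + norm (y - c) * r"
      using R_hull_subset_halfspace[OF \<open>0 < R\<close> _ _ y, of "y - c"] False by simp
    then have "norm (y - c) * norm (y - c) \<le> norm (y - c) * r"
      by (metis (no_types, lifting) add_diff_cancel_left' diff_le_eq inner_diff_right power2_eq_square power2_norm_eq_inner add.commute)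
    then show ?thesis
      using False by (simp add: dist_norm norm_minus_commute)
  qed (use assms in auto)
qed

section \<open>Chords and disks of radius \<open>R\<close>\<close>

lemma convex_hull_outside_ball:
  fixes c y :: "'a::euclidean_space"
  assumes "y \<in> convex hull S" "\<And>w. w \<in> S \<Longrightarrow> R \<le> dist y w"
  shows "\<exists>w\<in>S. R \<le> dist c w"
proof (rule ccontr)
  assume "\<not> ?thesis"
  \<comment> \<open>If all of \<open>S\<close> is within \<open>R\<close> of \<open>c\<close>, each
    of its points is strictly closer to \<open>c\<close> than to \<open>y\<close>, so it lies
    strictly on the \<open>c\<close> side of the hyperplane through \<open>y\<close> orthogonal to
    \<open>y - c\<close>.\<close>
  have "S \<subseteq> {w. (y - c) \<bullet> w < (y - c) \<bullet> y}"
  proof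
    fix w assume w: "w \<in> S"
    have "(norm (w - c))\<^sup>2 = (norm (w - y))\<^sup>2 + 2 * ((y - c) \<bullet> (w - y)) + (norm (y - c))\<^sup>2"
      by (simp add: power2_norm_eq_inner algebra_simps inner_commute)
    moreover have "norm (w - c) < norm (w - y)"
      using \<open>\<not> (\<exists>w\<in>S. R \<le> dist c w)\<close> w assms(2)[OF w]
      by (force simp: dist_norm norm_minus_commute)
    then have "(norm (w - c))\<^sup>2 < (norm (w - y))\<^sup>2"
      by (intro power_strict_mono) auto
    ultimately have "(y - c) \<bullet> (w - y) < 0"
      using zero_le_power2[of "norm (y - c)"] by linarith
    then show "w \<in> {w. (y - c) \<bullet> w < (y - c) \<bullet> y}"
      by (simp add: inner_diff_right)
  qed
  then have "convex hull S \<subseteq> {w. (y - c) \<bullet> w < (y - c) \<bullet> y}"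
    by (intro hull_minimal) (auto simp: convex_halfspace_lt)
  with assms(1) show False
    by auto
qed

text \<open>The chord ends are \<open>(-\<delta>, 0)\<close> and \<open>(\<delta>, 0)\<close>;
  \<open>(\<alpha>, \<beta>)\<close> is the centre of a disk of radius \<open>R\<close> that
  contains \<open>(0, \<zeta>)\<close> but neither end. The circles of radius \<open>R\<close>
  through both ends have centres \<open>(0, h)\<close> and \<open>(0, -h)\<close>, and
  \<open>\<bar>\<zeta>\<bar> \<le> R - h\<close> places \<open>(0, \<zeta>)\<close> in the lens
  common to their disks.\<close>

lemma chord_foot:
  fixes \<alpha> \<beta> \<delta> h R \<zeta> :: real
  assumes "\<delta> > 0" "h > 0" "R > 0" "h\<^sup>2 = R\<^sup>2 - \<delta>\<^sup>2" "\<bar>\<zeta>\<bar> \<le> R - h"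
    and "\<alpha>\<^sup>2 + (\<beta> - \<zeta>)\<^sup>2 < R\<^sup>2" "R\<^sup>2 \<le> (\<alpha> - \<delta>)\<^sup>2 + \<beta>\<^sup>2" "R\<^sup>2 \<le> (\<alpha> + \<delta>)\<^sup>2 + \<beta>\<^sup>2"
  shows "\<bar>\<alpha>\<bar> < \<delta>" "h \<le> \<bar>\<beta>\<bar>"
proof -
  have *: "R\<^sup>2 \<le> \<alpha>\<^sup>2 - 2 * \<bar>\<alpha>\<bar> * \<delta> + \<delta>\<^sup>2 + \<beta>\<^sup>2"
    using assms(7,8) by (cases "\<alpha> \<ge> 0") (auto simp: power2_eq_square algebra_simps)
  show lt: "\<bar>\<alpha>\<bar> < \<delta>"
  proof (rule ccontr)
    assume "\<not> \<bar>\<alpha>\<bar> < \<delta>"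
    then have "\<delta> * \<delta> \<le> \<bar>\<alpha>\<bar> * \<delta>" "\<delta>\<^sup>2 \<le> \<bar>\<alpha>\<bar>\<^sup>2"
      using assms(1) mult_right_mono[of \<delta> "\<bar>\<alpha>\<bar>" \<delta>] power_mono[of \<delta> "\<bar>\<alpha>\<bar>" 2] by linarith+
    then have 1: "\<delta>\<^sup>2 \<le> 2 * \<bar>\<alpha>\<bar> * \<delta> - \<delta>\<^sup>2" "\<delta>\<^sup>2 \<le> \<alpha>\<^sup>2"
      by (auto simp: power2_eq_square)
    have "(\<beta> - \<zeta>)\<^sup>2 < h\<^sup>2"
      using assms(4,6) 1 by linarith
    then have 2: "\<bar>\<beta> - \<zeta>\<bar> \<le> h"
      using assms(2) by (metis abs_le_square_iff abs_of_pos less_imp_le)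
    have "\<delta>\<^sup>2 < \<zeta>\<^sup>2 + 2 * (\<zeta> * (\<beta> - \<zeta>))"
      using * 1 assms(6) by (simp add: power2_eq_square algebra_simps)
    moreover have "\<zeta> * (\<beta> - \<zeta>) \<le> (R - h) * h"
    proof -
      have "\<zeta> * (\<beta> - \<zeta>) \<le> \<bar>\<zeta>\<bar> * \<bar>\<beta> - \<zeta>\<bar>"
        by (metis abs_ge_self abs_mult)
      also have "\<dots> \<le> (R - h) * h"
        using 2 assms by (intro mult_mono) auto
      finally show ?thesis .
    qed
    moreover have "\<zeta>\<^sup>2 \<le> (R - h)\<^sup>2"
      using assms(5) by (metis abs_le_square_iff abs_of_nonneg abs_ge_zero order_trans)
    ultimately have "\<delta>\<^sup>2 < (R - h)\<^sup>2 + 2 * ((R - h) * h)"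
      by linarith
    also have "\<dots> = R\<^sup>2 - h\<^sup>2"
      by (simp add: power2_eq_square algebra_simps)
    finally show False
      using assms(4) by linarith
  qed
  have "\<bar>\<alpha>\<bar> * \<bar>\<alpha>\<bar> \<le> \<bar>\<alpha>\<bar> * \<delta>" "0 \<le> \<bar>\<alpha>\<bar> * \<delta>"
    using mult_left_mono[of "\<bar>\<alpha>\<bar>" \<delta> "\<bar>\<alpha>\<bar>"] lt assms(1) by auto
  then have "h\<^sup>2 \<le> \<beta>\<^sup>2"
    using * assms(4) by (auto simp: power2_eq_square)
  then show "h \<le> \<bar>\<beta>\<bar>"
    using assms(2) by (metis abs_le_square_iff abs_of_pos)
qed

text \<open>The case \<open>\<zeta> = h - R\<close>, the lower tip of the lens. Together with
  \<open>h \<le> \<bar>\<beta>\<bar>\<close> from \<open>chord_foot\<close> it forces the centre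
  below the chord.\<close>

lemma chord_tip:
  fixes \<alpha> \<beta> \<delta> h R :: real
  assumes "\<delta> > 0" "h > 0" "R > 0" "h\<^sup>2 = R\<^sup>2 - \<delta>\<^sup>2"
    and "\<alpha>\<^sup>2 + (\<beta> + (R - h))\<^sup>2 < R\<^sup>2" "R\<^sup>2 \<le> (\<alpha> - \<delta>)\<^sup>2 + \<beta>\<^sup>2" "R\<^sup>2 \<le> (\<alpha> + \<delta>)\<^sup>2 + \<beta>\<^sup>2"
  shows "\<beta> < h"
proof -
  have "h < R"
    using assms by (smt (verit) power_mono zero_less_power2)
  have "R\<^sup>2 \<le> \<alpha>\<^sup>2 + \<beta>\<^sup>2 + \<delta>\<^sup>2"
    using assms(6,7) by (auto simp: power2_eq_square algebra_simps)
  with assms(5) have "2 * \<beta> * (R - h) + (R - h)\<^sup>2 < \<delta>\<^sup>2"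
    by (simp add: power2_eq_square algebra_simps)
  also have "\<delta>\<^sup>2 = (R - h) * (R + h)"
    using assms(4) by (simp add: power2_eq_square algebra_simps)
  finally have "(R - h) * (2 * \<beta> + (R - h)) < (R - h) * (R + h)"
    by (simp add: power2_eq_square algebra_simps)
  then show ?thesis
    using \<open>h < R\<close> by simp
qed

text \<open>The contradiction behind the reach bound. The line through \<open>y1\<close> and
  \<open>y2\<close>, with normal \<open>n\<close>, crosses the segment from \<open>p\<close> to
  \<open>q\<close> at \<open>k\<close>. If \<open>A\<close> misses this line, then \<open>A\<close>
  and hence its hull stay on one side, against the positions of \<open>p\<close> and
  \<open>q\<close>.\<close>

lemma R_hull_separating_balls:
  fixes A :: "(real^2) set"
  assumes A: "connected A" "A \<subseteq> ball c R" and R: "R > 0"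
    and pq: "p \<in> R_hull R A" "q \<in> R_hull R A" "p \<in> ball c R" "q \<in> ball c R"
    and disj: "A \<inter> ball y1 R = {}" "A \<inter> ball y2 R = {}"
    and far: "R \<le> dist y1 p" "R \<le> dist y1 q" "R \<le> dist y2 p" "R \<le> dist y2 q"
    and y12: "dist y1 y2 < 2 * R"
    and k: "k \<in> open_segment y1 y2" "k \<in> closed_segment p q"
    and n: "n \<bullet> (y2 - y1) = 0" "n \<bullet> (p - y1) < 0" "0 < n \<bullet> (q - y1)"
    and line: "\<And>w. n \<bullet> (w - y1) = 0 \<Longrightarrow> \<exists>\<sigma>. w = y1 + \<sigma> *\<^sub>R (y2 - y1)"
  shows False
proof -
  have k_hull: "k \<in> convex hull {p, q, w}" for w
    using k(2) hull_mono[of "{p, q}" "{p, q, w}" convex] by (auto simp: segment_convex_hull)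
  obtain \<tau> where \<tau>: "k = (1 - \<tau>) *\<^sub>R y1 + \<tau> *\<^sub>R y2" "0 < \<tau>" "\<tau> < 1"
    using k(1) by (auto simp: in_segment)
  \<comment> \<open>As \<open>k\<close> is between \<open>p\<close> and \<open>q\<close>, a centre
    \<open>y\<close> between \<open>k\<close> and \<open>w\<close> belongs to the triangle
    \<open>p\<close>, \<open>q\<close>, \<open>w\<close>. Its vertices are at distance at least
    \<open>R\<close> from \<open>y\<close>, yet all lie in \<open>ball c R\<close>.\<close>
  have outside: False
    if "w \<in> A" "y \<in> {y1, y2}" "y \<in> closed_segment k w" for w y
  proof -
    have "y \<in> convex hull {p, q, w}"
    proof -
      have "closed_segment k w \<subseteq> convex hull {p, q, w}"
        using k_hull by (intro closed_segment_subset) (auto intro: hull_inc)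
      with that show ?thesis by blast
    qed
    moreover have "R \<le> dist y v" if "v \<in> {p, q, w}" for v
      using that far disj \<open>w \<in> A\<close> \<open>y \<in> {y1, y2}\<close> by (fastforce simp: not_less)
    ultimately obtain v where "v \<in> {p, q, w}" "R \<le> dist c v"
      using convex_hull_outside_ball by blast
    then show False
      using pq A \<open>w \<in> A\<close> by auto
  qed
  have ne: "n \<bullet> (w - y1) \<noteq> 0" if w: "w \<in> A" for w
  proof
    assume "n \<bullet> (w - y1) = 0"
    then obtain \<sigma> where \<sigma>: "w = y1 + \<sigma> *\<^sub>R (y2 - y1)"
      using line by blast
    \<comment> \<open>If \<open>w\<close> is outside the segment from \<open>y1\<close> to
      \<open>y2\<close>, a centre lies between \<open>k\<close> and \<open>w\<close>. On the
      segment, \<open>w\<close> is within half of \<open>dist y1 y2 < 2 * R\<close> of the nearer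
      centre, hence in a disk that misses \<open>A\<close>.\<close>
    consider "\<sigma> < 0" | "\<sigma> > 1" | "0 \<le> \<sigma>" "\<sigma> \<le> 1 / 2" | "1 / 2 \<le> \<sigma>" "\<sigma> \<le> 1"
      by linarith
    then show False
    proof cases
      case 1
      have "y1 = (1 - \<tau> / (\<tau> - \<sigma>)) *\<^sub>R k + (\<tau> / (\<tau> - \<sigma>)) *\<^sub>R w"
      proof -
        have "(1 - \<tau> / (\<tau> - \<sigma>)) *\<^sub>R k + (\<tau> / (\<tau> - \<sigma>)) *\<^sub>R w
          = y1 + ((1 - \<tau> / (\<tau> - \<sigma>)) * \<tau> + (\<tau> / (\<tau> - \<sigma>)) * \<sigma>) *\<^sub>R (y2 - y1)"
          unfolding \<sigma> \<tau>(1) by (simp add: algebra_simps)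
        also have "(1 - \<tau> / (\<tau> - \<sigma>)) * \<tau> + (\<tau> / (\<tau> - \<sigma>)) * \<sigma> = 0"
          using 1 \<tau> by (simp add: field_simps)
        finally show ?thesis by simp
      qed
      then have "y1 \<in> closed_segment k w"
        using 1 \<tau> unfolding in_segment by (intro exI[of _ "\<tau> / (\<tau> - \<sigma>)"]) auto
      then show False using outside w by blast
    next
      case 2
      define \<rho> where "\<rho> = (1 - \<tau>) / (\<sigma> - \<tau>)"
      have "(1 - \<rho>) *\<^sub>R k + \<rho> *\<^sub>R w = y1 + ((1 - \<rho>) * \<tau> + \<rho> * \<sigma>) *\<^sub>R (y2 - y1)"
        unfolding \<sigma> \<tau>(1) by (simp add: algebra_simps)
      also have "(1 - \<rho>) * \<tau> + \<rho> * \<sigma> = 1"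
      proof -
        have "\<rho> * (\<sigma> - \<tau>) = 1 - \<tau>"
          using 2 \<tau> by (simp add: \<rho>_def)
        then show ?thesis
          by (simp add: algebra_simps)
      qed
      finally have "y2 = (1 - \<rho>) *\<^sub>R k + \<rho> *\<^sub>R w" by simp
      then have "y2 \<in> closed_segment k w"
        using 2 \<tau> unfolding in_segment by (intro exI[of _ \<rho>]) (auto simp: \<rho>_def)
      then show False using outside w by blast
    next
      case 3
      have "dist y1 w = \<sigma> * dist y1 y2"
        using 3 unfolding \<sigma> by (simp add: dist_norm norm_minus_commute)
      also have "\<dots> \<le> 1 / 2 * dist y1 y2"
        using 3 by (intro mult_right_mono) auto
      finally show False using y12 w disj by auto
    next
      case 4
      have "y2 - w = (1 - \<sigma>) *\<^sub>R (y2 - y1)"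
        unfolding \<sigma> by (simp add: algebra_simps)
      then have "dist y2 w = (1 - \<sigma>) * dist y1 y2"
        using 4 by (simp add: dist_norm norm_minus_commute)
      also have "\<dots> \<le> 1 / 2 * dist y1 y2"
        using 4 by (intro mult_right_mono) auto
      finally show False using y12 w disj by auto
    qed
  qed
  have "connected ((\<lambda>w. n \<bullet> (w - y1)) ` A)"
    by (intro connected_continuous_image A continuous_intros)
  then have "(\<forall>w\<in>A. n \<bullet> (w - y1) < 0) \<or> (\<forall>w\<in>A. 0 < n \<bullet> (w - y1))"
    using ne unfolding connected_iff_interval
    by (smt (verit, ccfv_threshold) image_iff)
  then consider "\<And>w. w \<in> A \<Longrightarrow> n \<bullet> w \<le> n \<bullet> y1" | "\<And>w. w \<in> A \<Longrightarrow> - n \<bullet> w \<le> - n \<bullet> y1"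
    by (auto simp: inner_diff_right less_imp_le)
  then show False
  proof cases
    case 1
    have "n \<noteq> 0" using n by auto
    from R_hull_subset_halfspace[OF R this 1 pq(2)] show False
      using n by (simp add: inner_diff_right)
  next
    case 2
    have "- n \<noteq> 0" using n by auto
    from R_hull_subset_halfspace[OF R this 2 pq(1)] show False
      using n by (simp add: inner_diff_right)
  qed
qed

section \<open>Uniqueness of nearest points\<close>

definition rot90 :: "real^2 \<Rightarrow> real^2" where
  "rot90 v = vector [- v $ 2, v $ 1]"

lemma inner_rot90 [simp]: "rot90 v \<bullet> v = 0" "v \<bullet> rot90 v = 0"
  by (auto simp: rot90_def inner_vec_def sum_2)

lemma rot90_inner_rot90 [simp]: "rot90 v \<bullet> rot90 w = v \<bullet> w"
  by (simp add: rot90_def inner_vec_def sum_2)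

lemma inner_rot90_swap: "rot90 v \<bullet> w = - (v \<bullet> rot90 w)"
  by (simp add: rot90_def inner_vec_def sum_2)

lemma orthogonal_rot90_imp_parallel:
  assumes "v \<noteq> 0" "rot90 v \<bullet> w = 0"
  shows "\<exists>\<sigma>. w = \<sigma> *\<^sub>R v"
proof -
  have "v $ 1 * w $ 2 = v $ 2 * w $ 1"
    using assms(2) by (simp add: rot90_def inner_vec_def sum_2)
  moreover have "v $ 1 \<noteq> 0 \<or> v $ 2 \<noteq> 0"
    using assms(1) by (auto simp: vec_eq_iff forall_2)
  ultimately have "w = (w $ 1 / v $ 1) *\<^sub>R v \<or> w = (w $ 2 / v $ 2) *\<^sub>R v"
    by (auto simp: vec_eq_iff forall_2 field_simps)
  then show ?thesis by blast
qed

text \<open>Lagrange's identity, used to compute distances in the frame \<open>f\<close>,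
  \<open>rot90 f\<close>.\<close>

lemma norm_rot90_coordinates:
  assumes "norm f = 1"
  shows "(norm w)\<^sup>2 = (w \<bullet> f)\<^sup>2 + (w \<bullet> rot90 f)\<^sup>2"
proof -
  have "(w \<bullet> f)\<^sup>2 + (w \<bullet> rot90 f)\<^sup>2 = (norm w)\<^sup>2 * (norm f)\<^sup>2"
    unfolding power2_norm_eq_inner
    by (simp add: rot90_def inner_vec_def sum_2) (simp add: power2_eq_square algebra_simps)
  with assms show ?thesis by simp
qed

text \<open>Coordinates \<open>u\<close> along and \<open>v\<close> across the chord from
  \<open>p\<close> to \<open>q\<close>, with origin at its midpoint \<open>m\<close>, reduce the
  metric part to \<open>chord_foot\<close> and \<open>chord_tip\<close>.\<close>

lemma R_hull_unique_nearest:
  fixes A :: "(real^2) set"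
  assumes A: "connected A" "A \<subseteq> cball c r" "0 \<le> r" "r < R"
    and p: "is_nearest_point (R_hull R A) x p" and q: "is_nearest_point (R_hull R A) x q"
    and d: "dist x p < R"
  shows "p = q"
proof (rule ccontr)
  assume "p \<noteq> q"
  define m where "m = (1 / 2) *\<^sub>R (p + q)"
  define \<delta> where "\<delta> = norm (q - p) / 2"
  define f where "f = (q - p) /\<^sub>R norm (q - p)"
  define e where "e = rot90 f"
  \<comment> \<open>Distance from \<open>m\<close> to the centres of the two circles of radius
    \<open>R\<close> through \<open>p\<close> and \<open>q\<close>.\<close>
  define h where "h = sqrt (R\<^sup>2 - \<delta>\<^sup>2)"
  define u where "u y = (y - m) \<bullet> f" for y
  define v where "v y = (y - m) \<bullet> e" for y
  have R: "0 < R" using A by simp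
  have \<delta>: "\<delta> > 0" using \<open>p \<noteq> q\<close> by (simp add: \<delta>_def)
  have "norm f = 1"
    using \<open>p \<noteq> q\<close> by (simp add: f_def)
  then have f: "norm f = 1" "f \<bullet> f = 1" "e \<bullet> e = 1" "e \<bullet> f = 0" "f \<bullet> e = 0"
    by (auto simp: e_def norm_eq_1)
  have pm: "p = m - \<delta> *\<^sub>R f" and qm: "q = m + \<delta> *\<^sub>R f"
  proof -
    have "\<delta> *\<^sub>R f = (1 / 2) *\<^sub>R (q - p)"
      using \<open>p \<noteq> q\<close> by (simp add: \<delta>_def f_def)
    then show "p = m - \<delta> *\<^sub>R f" "q = m + \<delta> *\<^sub>R f"
      by (auto simp: m_def vec_eq_iff field_simps)
  qed
  have dist_uv: "(dist y z)\<^sup>2 = (u y - u z)\<^sup>2 + (v y - v z)\<^sup>2" for y z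
    using norm_rot90_coordinates[OF f(1), of "y - z"]
    by (simp add: dist_norm u_def v_def e_def inner_diff_left)
  have uv [simp]: "u p = - \<delta>" "u q = \<delta>" "v p = 0" "v q = 0"
      "u (m + \<zeta> *\<^sub>R e) = 0" "v (m + \<zeta> *\<^sub>R e) = \<zeta>" for \<zeta>
    by (auto simp: u_def v_def pm qm f)
  have "dist x p = dist x q"
    using p q unfolding is_nearest_point_def by (meson order_antisym)
  then have "(u x + \<delta>)\<^sup>2 = (u x - \<delta>)\<^sup>2"
    using dist_uv[of x p] dist_uv[of x q] by simp
  then have "u x = 0"
    using \<delta> by (simp add: power2_eq_square algebra_simps)
  have d2: "(dist x p)\<^sup>2 = \<delta>\<^sup>2 + (v x)\<^sup>2"
    using dist_uv[of x p] \<open>u x = 0\<close> by simp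
  have "(dist x p)\<^sup>2 < R\<^sup>2"
    using d by (intro power_strict_mono) auto
  then have vx: "(v x)\<^sup>2 < R\<^sup>2 - \<delta>\<^sup>2"
    using d2 by simp
  then have "0 < R\<^sup>2 - \<delta>\<^sup>2"
    using zero_le_power2[of "v x"] by linarith
  then have h: "h > 0" "h\<^sup>2 = R\<^sup>2 - \<delta>\<^sup>2"
    by (auto simp: h_def)
  have "\<bar>v x\<bar> < h"
    using vx h by (metis power2_abs power_less_imp_less_base less_imp_le)
  have "h\<^sup>2 < R\<^sup>2"
    using h \<delta> by simp
  then have "h < R"
    using R by (simp add: power_less_imp_less_base)
  define Y where "Y = {y. A \<inter> ball y R = {}}"
  have far: "R \<le> dist y p" "R \<le> dist y q" if "y \<in> Y" for y
    using that p q R_hull_disjoint[of A y R] by (auto simp: Y_def is_nearest_point_def)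
  have far2: "R\<^sup>2 \<le> (u y + \<delta>)\<^sup>2 + (v y)\<^sup>2" "R\<^sup>2 \<le> (u y - \<delta>)\<^sup>2 + (v y)\<^sup>2" if "y \<in> Y" for y
    using far[OF that] R dist_uv[of y p] dist_uv[of y q]
    by (auto dest!: power_mono[of R _ 2])
  have near2: "(u y)\<^sup>2 + (v y - \<zeta>)\<^sup>2 < R\<^sup>2" if "dist y (m + \<zeta> *\<^sub>R e) < R" for y \<zeta>
    using power_strict_mono[OF that, of 2] dist_uv[of y "m + \<zeta> *\<^sub>R e"] by simp
  have foot: "\<bar>u y\<bar> < \<delta>" "v y \<noteq> 0"
    if "y \<in> Y" "dist y (m + \<zeta> *\<^sub>R e) < R" "\<bar>\<zeta>\<bar> \<le> R - h" for y \<zeta>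
    using chord_foot[OF \<delta> h(1) R h(2) that(3) near2[OF that(2)]] far2[OF that(1)] h by auto
  \<comment> \<open>As \<open>x\<close> is on the perpendicular bisector with
    \<open>\<bar>v x\<bar> < h\<close>, every bisector point in the lens is strictly closer to
    \<open>x\<close> than \<open>p\<close> is, so it is not in the hull.\<close>
  have covered: "\<exists>y\<in>Y. dist y (m + \<zeta> *\<^sub>R e) < R" if "\<bar>\<zeta>\<bar> \<le> R - h" for \<zeta>
  proof -
    have "(dist x (m + \<zeta> *\<^sub>R e))\<^sup>2 < (dist x p)\<^sup>2"
    proof -
      have "(dist x (m + \<zeta> *\<^sub>R e))\<^sup>2 = \<zeta>\<^sup>2 - 2 * (\<zeta> * v x) + (v x)\<^sup>2"
        using dist_uv[of x "m + \<zeta> *\<^sub>R e"] \<open>u x = 0\<close> by (simp add: power2_eq_square algebra_simps)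
      moreover have "\<zeta>\<^sup>2 - 2 * (\<zeta> * v x) < \<delta>\<^sup>2"
      proof -
        have "- (\<zeta> * v x) \<le> \<bar>\<zeta>\<bar> * \<bar>v x\<bar>"
          by (metis abs_ge_minus_self abs_mult)
        also have "\<dots> \<le> (R - h) * \<bar>v x\<bar>"
          using that by (intro mult_right_mono) auto
        also have "\<dots> < (R - h) * h"
          using \<open>\<bar>v x\<bar> < h\<close> \<open>h < R\<close> by simp
        finally have "- (\<zeta> * v x) < (R - h) * h" .
        moreover have "\<zeta>\<^sup>2 \<le> (R - h)\<^sup>2"
          using that power_mono[of "\<bar>\<zeta>\<bar>" "R - h" 2] by simp
        moreover have "(R - h)\<^sup>2 + 2 * ((R - h) * h) = \<delta>\<^sup>2"
          using h by (simp add: power2_eq_square algebra_simps)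
        ultimately show ?thesis by linarith
      qed
      ultimately show ?thesis using d2 by linarith
    qed
    then have "dist x (m + \<zeta> *\<^sub>R e) < dist x p"
      by (simp add: power_less_imp_less_base)
    then have "m + \<zeta> *\<^sub>R e \<notin> R_hull R A"
      using p unfolding is_nearest_point_def by force
    then show ?thesis
      by (auto simp: R_hull_def Y_def)
  qed
  \<comment> \<open>The parameters on the bisector covered from above and from below the chord line;
    by \<open>foot\<close>, no centre covering a point of the lens segment is on that line.\<close>
  define U where "U = {\<zeta>. \<exists>y\<in>Y. 0 < v y \<and> dist y (m + \<zeta> *\<^sub>R e) < R}"
  define D where "D = {\<zeta>. \<exists>y\<in>Y. v y < 0 \<and> dist y (m + \<zeta> *\<^sub>R e) < R}"
  have op: "open {\<zeta>. dist y (m + \<zeta> *\<^sub>R e) < R}" for y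
    by (intro open_Collect_less continuous_intros)
  have "U = (\<Union>y\<in>{y\<in>Y. 0 < v y}. {\<zeta>. dist y (m + \<zeta> *\<^sub>R e) < R})"
       "D = (\<Union>y\<in>{y\<in>Y. v y < 0}. {\<zeta>. dist y (m + \<zeta> *\<^sub>R e) < R})"
    by (auto simp: U_def D_def)
  then have "open U" "open D"
    using op by auto
  moreover have "{h - R..R - h} \<subseteq> U \<union> D"
  proof
    fix \<zeta> assume "\<zeta> \<in> {h - R..R - h}"
    then have "\<bar>\<zeta>\<bar> \<le> R - h" by auto
    with covered foot(2) show "\<zeta> \<in> U \<union> D"
      unfolding U_def D_def by (metis (mono_tags, lifting) UnCI linorder_neqE_linordered_idom mem_Collect_eq)
  qed
  moreover have "R - h \<in> U"
  proof -
    obtain y where y: "y \<in> Y" "dist y (m + (R - h) *\<^sub>R e) < R"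
      using covered[of "R - h"] \<open>h < R\<close> by auto
    \<comment> \<open>Reflection in the chord line exchanges the two tips, so
      \<open>chord_tip\<close> applies with \<open>- v y\<close>.\<close>
    have "(u y)\<^sup>2 + (- v y + (R - h))\<^sup>2 < R\<^sup>2"
      using near2[OF y(2)] by (simp add: power2_eq_square algebra_simps)
    then have "- v y < h"
      using far2[OF y(1)] by (intro chord_tip[OF \<delta> h(1) R h(2)]) auto
    moreover have "h \<le> \<bar>v y\<bar>"
      using chord_foot(2)[OF \<delta> h(1) R h(2) _ near2[OF y(2)]] far2[OF y(1)] \<open>h < R\<close> by auto
    ultimately show ?thesis
      using y h unfolding U_def by force
  qed
  moreover have "h - R \<in> D"
  proof -
    obtain y where y: "y \<in> Y" "dist y (m + (h - R) *\<^sub>R e) < R"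
      using covered[of "h - R"] \<open>h < R\<close> by auto
    have "(u y)\<^sup>2 + (v y + (R - h))\<^sup>2 < R\<^sup>2"
      using near2[OF y(2)] by (simp add: power2_eq_square algebra_simps)
    then have "v y < h"
      using far2[OF y(1)] by (intro chord_tip[OF \<delta> h(1) R h(2)]) auto
    moreover have "h \<le> \<bar>v y\<bar>"
      using chord_foot(2)[OF \<delta> h(1) R h(2) _ near2[OF y(2)]] far2[OF y(1)] \<open>h < R\<close> by auto
    ultimately show ?thesis
      using y h unfolding D_def by force
  qed
  \<comment> \<open>Otherwise the open sets \<open>U\<close> and \<open>D\<close>, each containing
    one end point, would disconnect the interval.\<close>
  ultimately have "U \<inter> D \<inter> {h - R..R - h} \<noteq> {}"
    using connectedD[OF connected_Icc[of "h - R" "R - h"], of U D] \<open>h < R\<close> by fastforce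
  then obtain \<zeta> where "\<zeta> \<in> U" "\<zeta> \<in> D" and "\<zeta> \<in> {h - R..R - h}"
    by blast
  then have \<zeta>: "\<bar>\<zeta>\<bar> \<le> R - h"
    by auto
  obtain y1 where y1: "y1 \<in> Y" "v y1 < 0" "dist y1 (m + \<zeta> *\<^sub>R e) < R"
    using \<open>\<zeta> \<in> D\<close> unfolding D_def by auto
  obtain y2 where y2: "y2 \<in> Y" "0 < v y2" "dist y2 (m + \<zeta> *\<^sub>R e) < R"
    using \<open>\<zeta> \<in> U\<close> unfolding U_def by auto
  \<comment> \<open>The parameter at which the segment from \<open>y1\<close> to \<open>y2\<close>
    crosses the chord line.\<close>
  define \<tau> where "\<tau> = - v y1 / (v y2 - v y1)"
  define k where "k = y1 + \<tau> *\<^sub>R (y2 - y1)"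
  have \<tau>: "0 < \<tau>" "\<tau> < 1"
    using y1 y2 by (auto simp: \<tau>_def field_simps)
  have uk: "u k = (1 - \<tau>) * u y1 + \<tau> * u y2" and vk: "v k = (1 - \<tau>) * v y1 + \<tau> * v y2"
    by (auto simp: k_def u_def v_def inner_diff_left inner_add_left algebra_simps)
  have "v k = 0"
  proof -
    have "\<tau> * (v y2 - v y1) = - v y1"
      using y1 y2 by (simp add: \<tau>_def)
    then show ?thesis
      by (simp add: vk algebra_simps)
  qed
  \<comment> \<open>Both centres project strictly between the chord ends, hence so does their convex
    combination \<open>k\<close>.\<close>
  have "u y1 \<in> {- \<delta><..<\<delta>}" "u y2 \<in> {- \<delta><..<\<delta>}"
    using foot(1)[OF y1(1,3) \<zeta>] foot(1)[OF y2(1,3) \<zeta>] by auto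
  then have "u k \<in> {- \<delta><..<\<delta>}"
    unfolding uk using \<tau> convexD[of "{- \<delta><..<\<delta>}" "u y1" "u y2" "1 - \<tau>" \<tau>] by simp
  have km: "k = m + u k *\<^sub>R f"
  proof -
    have "(dist k (m + u k *\<^sub>R f))\<^sup>2 = 0"
      unfolding dist_uv using \<open>v k = 0\<close> by (simp add: u_def v_def f)
    then show ?thesis by simp
  qed
  have k_pq: "k \<in> closed_segment p q"
    unfolding in_segment
  proof (intro exI conjI)
    define \<rho> where "\<rho> = (u k + \<delta>) / (2 * \<delta>)"
    show "k = (1 - \<rho>) *\<^sub>R p + \<rho> *\<^sub>R q"
    proof -
      have "(1 - \<rho>) *\<^sub>R p + \<rho> *\<^sub>R q = m + (2 * \<delta> * \<rho> - \<delta>) *\<^sub>R f"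
        by (simp add: pm qm vec_eq_iff algebra_simps)
      also have "2 * \<delta> * \<rho> - \<delta> = u k"
        using \<delta> by (simp add: \<rho>_def)
      finally show ?thesis using km by simp
    qed
    show "0 \<le> \<rho>" "\<rho> \<le> 1"
      using \<open>u k \<in> {- \<delta><..<\<delta>}\<close> \<delta> by (auto simp: \<rho>_def field_simps)
  qed
  have "y1 \<noteq> y2"
    using y1 y2 by auto
  have k_y: "k \<in> open_segment y1 y2"
    unfolding in_segment using \<tau> \<open>y1 \<noteq> y2\<close>
    by (intro conjI exI[of _ \<tau>]) (simp_all add: k_def algebra_simps)
  \<comment> \<open>The sign makes \<open>n \<bullet> f = v y2 - v y1\<close> positive, which puts
    \<open>p\<close> on the negative and \<open>q\<close> on the positive side.\<close>
  define n where "n = - rot90 (y2 - y1)"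
  have nf: "n \<bullet> f = v y2 - v y1"
    by (simp add: n_def v_def e_def inner_rot90_swap inner_diff_left)
  have nk: "n \<bullet> (k - y1) = 0"
    by (simp add: n_def k_def)
  have "p - y1 = (k - y1) - (u k + \<delta>) *\<^sub>R f" "q - y1 = (k - y1) + (\<delta> - u k) *\<^sub>R f"
    using km by (auto simp: pm qm algebra_simps)
  then have np: "n \<bullet> (p - y1) = - ((u k + \<delta>) * (v y2 - v y1))"
    and nq: "n \<bullet> (q - y1) = (\<delta> - u k) * (v y2 - v y1)"
    using nk nf by (auto simp: inner_diff_right inner_add_right)
  have hull_ball: "R_hull R A \<subseteq> ball c R"
    using R_hull_subset_cball[OF A(3) R A(2)] A(4) by auto
  show False
  proof (rule R_hull_separating_balls[of A c R p q y1 y2 k n])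
    show "dist y1 y2 < 2 * R"
      using y1(3) y2(3) dist_triangle2[of y1 y2 "m + \<zeta> *\<^sub>R e"] by linarith
    show "\<exists>\<sigma>. w = y1 + \<sigma> *\<^sub>R (y2 - y1)" if "n \<bullet> (w - y1) = 0" for w
      using orthogonal_rot90_imp_parallel[of "y2 - y1" "w - y1"] that \<open>y1 \<noteq> y2\<close>
      by (auto simp: n_def algebra_simps)
    show "n \<bullet> (p - y1) < 0" "0 < n \<bullet> (q - y1)"
      unfolding np nq using \<open>u k \<in> {- \<delta><..<\<delta>}\<close> y1 y2 by auto
    show "p \<in> R_hull R A" "q \<in> R_hull R A"
      using p q by (auto simp: is_nearest_point_def)
    then show "p \<in> ball c R" "q \<in> ball c R"
      using hull_ball by auto
  qed (use A R y1 y2 far k_y k_pq in \<open>auto simp: Y_def n_def subset_iff\<close>)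
qed

text \<open>A point within \<open>R\<close> of the closed hull has a nearest point at distance below
  \<open>R\<close>, so uniqueness applies and \<open>R\<close> itself is an admissible radius
  everywhere.\<close>

lemma reach_R_hull:
  fixes A :: "(real^2) set"
  assumes "connected A" "A \<subseteq> cball c r" "0 \<le> r" "r < R"
  shows "ereal R \<le> reach (R_hull R A)"
  unfolding reach_def
proof (rule INF_greatest)
  fix a assume a: "a \<in> R_hull R A"
  have "\<exists>!p. is_nearest_point (R_hull R A) x p" if x: "x \<in> ball a R" for x
  proof -
    have "R_hull R A \<noteq> {}"
      using a by blast
    then obtain p where "p \<in> R_hull R A" "\<And>y. y \<in> R_hull R A \<Longrightarrow> dist x p \<le> dist x y"
      using distance_attains_inf[OF closed_R_hull] by metis
    then have p: "is_nearest_point (R_hull R A) x p"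
      by (simp add: is_nearest_point_def)
    then have "dist x p \<le> dist x a"
      using a by (auto simp: is_nearest_point_def)
    then have "dist x p < R"
      using x by (simp add: dist_commute)
    with p R_hull_unique_nearest[OF assms p] show ?thesis
      by blast
  qed
  then show "ereal R \<le> reach_at (R_hull R A) a"
    unfolding reach_at_def using assms by (intro Sup_upper) auto
qed

section \<open>Arc length\<close>

text \<open>Points may repeat and \<open>u\<close>, \<open>v\<close> need not occur, so clamping a
  partition to a subinterval or joining two partitions gives a partition again.\<close>

definition is_partition :: "real \<Rightarrow> real \<Rightarrow> nat \<Rightarrow> (nat \<Rightarrow> real) \<Rightarrow> bool" where
  "is_partition u v n p \<longleftrightarrow> mono_on {..n} p \<and> p ` {..n} \<subseteq> {u..v}"

definition polygon_length :: "(real \<Rightarrow> 'a::metric_space) \<Rightarrow> nat \<Rightarrow> (nat \<Rightarrow> real) \<Rightarrow> real" where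
  "polygon_length g n p = (\<Sum>i<n. dist (g (p i)) (g (p (Suc i))))"

lemma curve_length_altdef:
  "curve_length g u v = Sup {ereal (polygon_length g n p) | n p. is_partition u v n p}"
  unfolding curve_length_def is_partition_def polygon_length_def ..

lemma polygon_length_le: "is_partition u v n p \<Longrightarrow> ereal (polygon_length g n p) \<le> curve_length g u v"
  unfolding curve_length_altdef by (auto intro: Sup_upper)

lemma curve_length_le:
  "(\<And>n p. is_partition u v n p \<Longrightarrow> ereal (polygon_length g n p) \<le> M) \<Longrightarrow> curve_length g u v \<le> M"
  unfolding curve_length_altdef by (auto intro: Sup_least)

lemma is_partition_le: "is_partition u v n p \<Longrightarrow> i \<le> j \<Longrightarrow> j \<le> n \<Longrightarrow> p i \<le> p j"
  by (auto simp: is_partition_def mono_on_def)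

lemma is_partition_mem: "is_partition u v n p \<Longrightarrow> i \<le> n \<Longrightarrow> u \<le> p i \<and> p i \<le> v"
  by (auto simp: is_partition_def)

lemma is_partitionI:
  "(\<And>i j. i \<le> j \<Longrightarrow> j \<le> n \<Longrightarrow> p i \<le> p j) \<Longrightarrow> (\<And>i. i \<le> n \<Longrightarrow> u \<le> p i \<and> p i \<le> v) \<Longrightarrow> is_partition u v n p"
  by (auto simp: is_partition_def mono_on_def)

lemma is_partition_min:
  assumes "is_partition u v n p" "u \<le> t"
  shows "is_partition u t n (\<lambda>i. min (p i) t)"
proof (rule is_partitionI)
  show "min (p i) t \<le> min (p j) t" if "i \<le> j" "j \<le> n" for i j
    using is_partition_le[OF assms(1) that] by auto
  show "u \<le> min (p i) t \<and> min (p i) t \<le> t" if "i \<le> n" for i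
    using is_partition_mem[OF assms(1) that] assms(2) by auto
qed

lemma is_partition_max:
  assumes "is_partition u v n p" "t \<le> v"
  shows "is_partition t v n (\<lambda>i. max (p i) t)"
proof (rule is_partitionI)
  show "max (p i) t \<le> max (p j) t" if "i \<le> j" "j \<le> n" for i j
    using is_partition_le[OF assms(1) that] by auto
  show "t \<le> max (p i) t \<and> max (p i) t \<le> v" if "i \<le> n" for i
    using is_partition_mem[OF assms(1) that] assms(2) by auto
qed

lemma is_partition_endpoints: "u \<le> v \<Longrightarrow> is_partition u v 1 (\<lambda>i. if i = 0 then u else v)"
  by (rule is_partitionI) auto

lemma polygon_length_endpoints: "polygon_length g 1 (\<lambda>i. if i = 0 then u else v) = dist (g u) (g v)"
  by (simp add: polygon_length_def)

lemma curve_length_nonneg: "u \<le> v \<Longrightarrow> 0 \<le> curve_length g u v"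
  using polygon_length_le[of u v 0 "\<lambda>_. u" g]
  by (auto simp: is_partition_def polygon_length_def mono_on_def zero_ereal_def)

lemma curve_length_mono: "u' \<le> u \<Longrightarrow> v \<le> v' \<Longrightarrow> curve_length g u v \<le> curve_length g u' v'"
  by (intro curve_length_le polygon_length_le) (auto simp: is_partition_def)

lemma curve_length_trivial [simp]: "curve_length g u u = 0"
proof (rule antisym[OF curve_length_le curve_length_nonneg])
  fix n p assume "is_partition u u n p"
  then have "p i = u" if "i \<le> n" for i
    using is_partition_mem that by (metis order_antisym)
  then show "ereal (polygon_length g n p) \<le> 0"
    by (simp add: polygon_length_def)
qed simp

lemma curve_length_split:
  assumes "u \<le> t" "t \<le> v"
  shows "curve_length g u v \<le> curve_length g u t + curve_length g t v"
proof (rule curve_length_le)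
  fix n p assume p: "is_partition u v n p"
  define p1 where "p1 i = min (p i) t" for i
  define p2 where "p2 i = max (p i) t" for i
  have "is_partition u t n p1" "is_partition t v n p2"
    unfolding p1_def p2_def using assms p by (auto intro: is_partition_min is_partition_max)
  then have *: "ereal (polygon_length g n p1) \<le> curve_length g u t"
      "ereal (polygon_length g n p2) \<le> curve_length g t v"
    by (auto intro: polygon_length_le)
  have "polygon_length g n p \<le> polygon_length g n p1 + polygon_length g n p2"
    unfolding polygon_length_def sum.distrib[symmetric]
  proof (rule sum_mono)
    fix i assume "i \<in> {..<n}"
    then have "p i \<le> p (Suc i)"
      by (intro is_partition_le[OF p]) auto
    \<comment> \<open>An edge on one side of \<open>t\<close> survives in one clamped polygon and
      collapses in the other; an edge across \<open>t\<close> is split there.\<close>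
    then consider "p (Suc i) \<le> t" | "t \<le> p i" | "p i < t" "t < p (Suc i)"
      by linarith
    then show "dist (g (p i)) (g (p (Suc i))) \<le>
        dist (g (p1 i)) (g (p1 (Suc i))) + dist (g (p2 i)) (g (p2 (Suc i)))"
    proof cases
      case 3
      then show ?thesis
        using dist_triangle[of "g (p i)" "g (p (Suc i))" "g t"] by (simp add: p1_def p2_def)
    qed (use \<open>p i \<le> p (Suc i)\<close> in \<open>auto simp: p1_def p2_def min_absorb1 max_absorb1 min_absorb2\<close>)
  qed
  then have "ereal (polygon_length g n p) \<le> ereal (polygon_length g n p1) + ereal (polygon_length g n p2)"
    by simp
  also have "\<dots> \<le> curve_length g u t + curve_length g t v"
    using * by (rule add_mono)
  finally show "ereal (polygon_length g n p) \<le> curve_length g u t + curve_length g t v" .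
qed

lemma polygon_length_concat:
  assumes "u \<le> t" "t \<le> v" and p: "is_partition u t n p" and q: "is_partition t v m q"
  shows "ereal (polygon_length g n p + polygon_length g m q) \<le> curve_length g u v"
proof -
  \<comment> \<open>The \<open>n + 1\<close> points of \<open>p\<close> are followed by the
    \<open>m + 1\<close> points of \<open>q\<close>, which gives \<open>Suc n + m\<close> edges. The
    joining edge is nonnegative and is dropped.\<close>
  define r where "r i = (if i \<le> n then p i else q (i - Suc n))" for i
  have "is_partition u v (Suc n + m) r"
  proof (rule is_partitionI)
    fix i j assume ij: "i \<le> j" "j \<le> Suc n + m"
    show "r i \<le> r j"
    proof (cases "i \<le> n \<and> \<not> j \<le> n")
      case True
      then have "p i \<le> t" "t \<le> q (j - Suc n)"
        using is_partition_mem[OF p, of i] is_partition_mem[OF q, of "j - Suc n"] ij by auto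
      then show ?thesis using True by (simp add: r_def)
    next
      case False
      then show ?thesis
        using is_partition_le[OF p, of i j] is_partition_le[OF q, of "i - Suc n" "j - Suc n"] ij
        by (auto simp: r_def)
    qed
  next
    fix i assume "i \<le> Suc n + m"
    then show "u \<le> r i \<and> r i \<le> v"
      using is_partition_mem[OF p, of i] is_partition_mem[OF q, of "i - Suc n"] assms(1,2)
      by (cases "i \<le> n") (auto simp: r_def le_diff_conv)
  qed
  then have "ereal (polygon_length g (Suc n + m) r) \<le> curve_length g u v"
    by (rule polygon_length_le)
  moreover have "polygon_length g n p + polygon_length g m q \<le> polygon_length g (Suc n + m) r"
  proof -
    have "polygon_length g (Suc n + m) r = (\<Sum>i<Suc n. dist (g (r i)) (g (r (Suc i)))) +
        (\<Sum>i<m. dist (g (r (Suc n + i))) (g (r (Suc (Suc n + i)))))"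
    proof -
      have "(\<Sum>i<k + m. h i) = (\<Sum>i<k. h i) + (\<Sum>i<m. h (k + i))" for h :: "nat \<Rightarrow> real" and k
        by (induction m) (auto simp: add.assoc)
      from this[of _ "Suc n"] show ?thesis
        unfolding polygon_length_def by simp
    qed
    moreover have "(\<Sum>i<m. dist (g (r (Suc n + i))) (g (r (Suc (Suc n + i))))) = polygon_length g m q"
      unfolding polygon_length_def by (intro sum.cong) (auto simp: r_def)
    moreover have "(\<Sum>i<n. dist (g (r i)) (g (r (Suc i)))) = polygon_length g n p"
      unfolding polygon_length_def by (intro sum.cong) (auto simp: r_def)
    ultimately show ?thesis by simp
  qed
  ultimately show ?thesis
    by (meson ereal_less_eq(3) order_trans)
qed

section \<open>Additivity and continuity of the length of a rectifiable curve\<close>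

context
  fixes g :: "real \<Rightarrow> real^2" and a b L :: real
  assumes ab: "a \<le> b" and cont: "continuous_on {a..b} g" and len: "curve_length g a b = ereal L"
begin

lemma curve_length_finite:
  assumes "a \<le> u" "u \<le> v" "v \<le> b"
  shows "curve_length g u v = ereal (real_of_ereal (curve_length g u v))"
proof -
  have "curve_length g u v \<le> ereal L" "0 \<le> curve_length g u v"
    using curve_length_mono[of a u v b g] curve_length_nonneg[of u v g] assms len by auto
  then show ?thesis
    by (intro ereal_real'[symmetric]) auto
qed

text \<open>Joined polygons have length at most \<open>L\<close>; suprema are taken first over the
  second polygon, then over the first. Finiteness permits the subtractions.\<close>

lemma curve_length_add:
  assumes "a \<le> t" "t \<le> b"
  shows "curve_length g a t + curve_length g t b = ereal L"
proof (rule antisym)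
  show "ereal L \<le> curve_length g a t + curve_length g t b"
    using curve_length_split[OF assms, of g] len by simp
  obtain x where x: "curve_length g a t = ereal x"
    using curve_length_finite[of a t] assms by auto
  obtain y where y: "curve_length g t b = ereal y"
    using curve_length_finite[of t b] assms by auto
  have "ereal (x + y) \<le> ereal L"
  proof -
    have 1: "polygon_length g m q \<le> L - polygon_length g n p"
      if "is_partition a t n p" "is_partition t b m q" for n p m q
      using polygon_length_concat[OF assms that, of g] len by simp
    have "y \<le> L - polygon_length g n p" if "is_partition a t n p" for n p
      using curve_length_le[of t b g "ereal (L - polygon_length g n p)"] 1[OF that] y by auto
    then have "polygon_length g n p \<le> L - y" if "is_partition a t n p" for n p
      using that by (simp add: algebra_simps)
    then have "x \<le> L - y"
      using curve_length_le[of a t g "ereal (L - y)"] x by auto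
    then show ?thesis by simp
  qed
  then show "curve_length g a t + curve_length g t b \<le> ereal L"
    using x y by simp
qed

text \<open>Serves for polygons whose vertices are clamped at a moving parameter \<open>s\<close> by
  \<open>min\<close> or \<open>max\<close>.\<close>

lemma polygon_length_deform:
  assumes t: "t \<in> {a..b}" and c: "\<And>s i. i \<le> n \<Longrightarrow> s \<in> {a..b} \<Longrightarrow> c s i \<in> {a..b}"
    "\<And>i. i \<le> n \<Longrightarrow> c t i = p i" "\<And>i. continuous_on UNIV (\<lambda>s. c s i)"
  shows "((\<lambda>s. polygon_length g n (c s)) \<longlongrightarrow> polygon_length g n p) (at t within {a..b})"
proof -
  have "((\<lambda>s. polygon_length g n (c s)) \<longlongrightarrow> polygon_length g n (c t)) (at t within {a..b})"
    unfolding polygon_length_def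
  proof (intro tendsto_sum tendsto_dist)
    fix i assume i: "i \<in> {..<n}"
    have "continuous_on {a..b} (\<lambda>s. g (c s j))" if "j \<le> n" for j
      using c(1) that
      by (intro continuous_on_compose2[OF cont] continuous_on_subset[OF c(3)]) auto
    from this[of i] this[of "Suc i"] i t
    show "((\<lambda>s. g (c s i)) \<longlongrightarrow> g (c t i)) (at t within {a..b})"
      "((\<lambda>s. g (c s (Suc i))) \<longlongrightarrow> g (c t (Suc i))) (at t within {a..b})"
      by (auto simp: continuous_on_def)
  qed
  also have "polygon_length g n (c t) = polygon_length g n p"
    unfolding polygon_length_def using c(2) by (intro sum.cong) auto
  finally show ?thesis .
qed

text \<open>Both \<open>t \<mapsto> curve_length g a t\<close> and \<open>t \<mapsto> curve_length g t b\<close> are lower semicontinuous,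
  being suprema of continuous functions; as their sum is constant, they are continuous.\<close>

lemma continuous_on_curve_length:
  "continuous_on {a..b} (\<lambda>t. real_of_ereal (curve_length g a t))"
  unfolding continuous_on_def
proof (intro ballI order_tendstoI)
  fix t w assume t: "t \<in> {a..b}"
  have sum: "real_of_ereal (curve_length g a s) + real_of_ereal (curve_length g s b) = L"
    if "s \<in> {a..b}" for s
    using curve_length_add[of s] curve_length_finite[of a s] curve_length_finite[of s b] that
    by (metis atLeastAtMost_iff ereal.inject order_refl plus_ereal.simps(1))
  {
    assume "w < real_of_ereal (curve_length g a t)"
    then have "\<not> curve_length g a t \<le> ereal w"
      using curve_length_finite[of a t] t by (metis atLeastAtMost_iff ereal_less_eq(3) not_le order_refl)
    then obtain n p where p: "is_partition a t n p" "w < polygon_length g n p"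
      using curve_length_le[of a t g "ereal w"] by (metis ereal_less_eq(3) not_le)
    have "((\<lambda>s. polygon_length g n (\<lambda>i. min (p i) s)) \<longlongrightarrow> polygon_length g n p) (at t within {a..b})"
      using is_partition_mem[OF p(1)] t
      by (intro polygon_length_deform continuous_intros) (auto simp: min_def)
    then have "\<forall>\<^sub>F s in at t within {a..b}. w < polygon_length g n (\<lambda>i. min (p i) s)"
      using p(2) by (rule order_tendstoD)
    then show "\<forall>\<^sub>F s in at t within {a..b}. w < real_of_ereal (curve_length g a s)"
      unfolding eventually_at_filter
    proof (rule eventually_mono, intro impI)
      fix s assume s: "s \<noteq> t \<longrightarrow> s \<in> {a..b} \<longrightarrow> w < polygon_length g n (\<lambda>i. min (p i) s)"
        "s \<noteq> t" "s \<in> {a..b}"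
      have "is_partition a s n (\<lambda>i. min (p i) s)"
        using p(1) s by (intro is_partition_min[of a t]) auto
      then have "ereal (polygon_length g n (\<lambda>i. min (p i) s)) \<le> curve_length g a s"
        by (rule polygon_length_le)
      then show "w < real_of_ereal (curve_length g a s)"
        using s curve_length_finite[of a s] by (cases "curve_length g a s") auto
    qed
  }
  {
    assume "real_of_ereal (curve_length g a t) < w"
    then have "L - w < real_of_ereal (curve_length g t b)"
      using sum[OF t] by simp
    then have "\<not> curve_length g t b \<le> ereal (L - w)"
      using curve_length_finite[of t b] t by (metis atLeastAtMost_iff ereal_less_eq(3) not_le order_refl)
    then obtain n p where p: "is_partition t b n p" "L - w < polygon_length g n p"
      using curve_length_le[of t b g "ereal (L - w)"] by (metis ereal_less_eq(3) not_le)
    have "((\<lambda>s. polygon_length g n (\<lambda>i. max (p i) s)) \<longlongrightarrow> polygon_length g n p) (at t within {a..b})"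
      using is_partition_mem[OF p(1)] t
      by (intro polygon_length_deform continuous_intros) (auto simp: max_def intro: antisym)
    then have "\<forall>\<^sub>F s in at t within {a..b}. L - w < polygon_length g n (\<lambda>i. max (p i) s)"
      using p(2) by (rule order_tendstoD)
    then show "\<forall>\<^sub>F s in at t within {a..b}. real_of_ereal (curve_length g a s) < w"
      unfolding eventually_at_filter
    proof (rule eventually_mono, intro impI)
      fix s assume s: "s \<noteq> t \<longrightarrow> s \<in> {a..b} \<longrightarrow> L - w < polygon_length g n (\<lambda>i. max (p i) s)"
        "s \<noteq> t" "s \<in> {a..b}"
      have "is_partition s b n (\<lambda>i. max (p i) s)"
        using p(1) s by (intro is_partition_max[of t b]) auto
      then have "ereal (polygon_length g n (\<lambda>i. max (p i) s)) \<le> curve_length g s b"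
        by (rule polygon_length_le)
      then have "L - w < real_of_ereal (curve_length g s b)"
        using s curve_length_finite[of s b] by (cases "curve_length g s b") auto
      then show "real_of_ereal (curve_length g a s) < w"
        using sum[OF s(3)] by simp
    qed
  }
qed

lemma curve_length_onto:
  assumes "0 \<le> s" "s \<le> L"
  shows "\<exists>t\<in>{a..b}. real_of_ereal (curve_length g a t) = s"
  using IVT'[of "\<lambda>t. real_of_ereal (curve_length g a t)" a s b] ab assms len
    continuous_on_curve_length by auto

lemma curve_length_real_mono:
  assumes "a \<le> t" "t \<le> t'" "t' \<le> b"
  shows "real_of_ereal (curve_length g a t) \<le> real_of_ereal (curve_length g a t')"
  using curve_length_mono[of a a t t' g] curve_length_finite[of a t] curve_length_finite[of a t'] assms
  by (metis ereal_less_eq(3) order_refl order_trans)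

text \<open>The edge from \<open>t\<close> to \<open>t'\<close> can be put in front of any polygon
  for \<open>{t'..b}\<close>; additivity turns remaining lengths into elapsed ones. This makes
  \<open>x\<close> 1-Lipschitz.\<close>

lemma dist_le_curve_length_diff:
  assumes "a \<le> t" "t \<le> t'" "t' \<le> b"
  shows "dist (g t) (g t') \<le> real_of_ereal (curve_length g a t') - real_of_ereal (curve_length g a t)"
proof -
  obtain x y z where xyz: "curve_length g a t = ereal x" "curve_length g t b = ereal y"
      "curve_length g t' b = ereal z"
    using curve_length_finite[of a t] curve_length_finite[of t b] curve_length_finite[of t' b] assms
    by auto
  obtain w where w: "curve_length g a t' = ereal w"
    using curve_length_finite[of a t'] assms by auto
  have "dist (g t) (g t') + z \<le> y"
  proof -
    have "polygon_length g n p \<le> y - dist (g t) (g t')" if "is_partition t' b n p" for n p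
      using polygon_length_concat[OF assms(2,3) is_partition_endpoints[OF assms(2)] that, of g] xyz
      unfolding polygon_length_endpoints by simp
    then have "z \<le> y - dist (g t) (g t')"
      using curve_length_le[of t' b g "ereal (y - dist (g t) (g t'))"] xyz by auto
    then show ?thesis by simp
  qed
  moreover have "x + y = L" "w + z = L"
    using curve_length_add[of t] curve_length_add[of t'] xyz w assms by auto
  ultimately show ?thesis
    using xyz w by simp
qed

end

section \<open>Lipschitz functions of a real variable are differentiable almost everywhere\<close>

text \<open>A Vitali cover of \<open>E\<close> by intervals with property \<open>P\<close>. The
  point \<open>x\<close> may be an end point, so that one-sided difference quotients
  qualify.\<close>

definition fine_cover :: "(real \<Rightarrow> real \<Rightarrow> bool) \<Rightarrow> real set \<Rightarrow> bool" where
  "fine_cover P E \<longleftrightarrow> (\<forall>x\<in>E. \<forall>d>0. \<exists>p q. p < q \<and> q - p < d \<and> p \<le> x \<and> x \<le> q \<and> P p q)"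

lemma fine_coverD:
  assumes "fine_cover P E" "x \<in> E" "d > 0"
  shows "\<exists>p q. p < q \<and> q - p < d \<and> p \<le> x \<and> x \<le> q \<and> P p q"
  using assms unfolding fine_cover_def by blast

lemma fine_cover_subset: "fine_cover P E \<Longrightarrow> F \<subseteq> E \<Longrightarrow> fine_cover P F"
  unfolding fine_cover_def by blast

text \<open>Vitali's theorem for closed balls, an interval being the ball around its midpoint.
  Discarding intervals that leave \<open>U\<close> keeps the cover fine, since \<open>U\<close> is
  open.\<close>

lemma Vitali_intervals:
  assumes "fine_cover P E" "open U" "E \<subseteq> U"
  obtains C :: "(real \<times> real) set" where "countable C"
    "\<And>p q. (p, q) \<in> C \<Longrightarrow> p < q \<and> {p..q} \<subseteq> U \<and> P p q"
    "disjoint_family_on (\<lambda>(p, q). {p..q}) C"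
    "E - (\<Union>(p, q)\<in>C. {p..q}) \<in> null_sets lebesgue"
proof -
  define K where "K = {(p, q). p < q \<and> {p..q} \<subseteq> U \<and> P p q}"
  define a where "a = (\<lambda>(p, q). (p + q) / 2 :: real)"
  define r where "r = (\<lambda>(p, q). (q - p) / 2 :: real)"
  have cb: "cball (a i) (r i) = (case i of (p, q) \<Rightarrow> {p..q})" for i
    by (auto simp: a_def r_def cball_eq_atLeastAtMost field_simps split: prod.splits)
  have rK: "0 < r i" if "i \<in> K" for i
    using that by (auto simp: K_def r_def)
  have cov: "\<exists>i. i \<in> K \<and> x \<in> cball (a i) (r i) \<and> r i < d" if x: "x \<in> E" and d: "0 < d" for x d
  proof -
    obtain e where e: "e > 0" "ball x e \<subseteq> U"
      using assms(2,3) x unfolding open_contains_ball by blast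
    obtain p q where pq: "p < q" "q - p < min d e" "p \<le> x" "x \<le> q" "P p q"
      using fine_coverD[OF assms(1) x, of "min d e"] d e(1) by auto
    then have "{p..q} \<subseteq> ball x e"
      by (auto simp: dist_real_def)
    with pq e have "(p, q) \<in> K"
      by (auto simp: K_def)
    moreover have "r (p, q) < d"
      using pq by (simp add: r_def)
    ultimately show ?thesis
      using pq by (intro exI[of _ "(p, q)"]) (simp add: cb del: mem_cball)
  qed
  obtain C where C: "countable C" "C \<subseteq> K"
     "pairwise (\<lambda>i j. disjnt (cball (a i) (r i)) (cball (a j) (r j))) C"
     "negligible (E - (\<Union>i \<in> C. cball (a i) (r i)))"
    using Vitali_covering_theorem_cballs[of K r E a, OF rK cov] by blast
  show ?thesis
  proof (rule that[of C])
    show "disjoint_family_on (\<lambda>(p, q). {p..q}) C"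
      using C(3) by (auto simp: disjoint_family_on_def pairwise_def disjnt_def cb)
    show "E - (\<Union>(p, q)\<in>C. {p..q}) \<in> null_sets lebesgue"
      using C(4) by (simp add: cb negligible_iff_null_sets case_prod_unfold)
  qed (use C K_def in auto)
qed

text \<open>On disjoint intervals covering almost all of \<open>E\<close>, \<open>v\<close> times
  the length is at most the increase of \<open>f\<close>, and by monotonicity these increases add up
  to at most \<open>f b - f a\<close>.\<close>

lemma emeasure_le_fine_cover_slope:
  fixes f :: "real \<Rightarrow> real"
  assumes f: "mono f" and "a \<le> b" "0 \<le> v"
    and E: "E \<in> sets lebesgue" "E \<subseteq> {a<..<b}"
    and fine: "fine_cover (\<lambda>p q. v * (q - p) \<le> f q - f p) E"
  shows "ennreal v * emeasure lebesgue E \<le> ennreal (f b - f a)"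
proof -
  obtain C where C: "countable C"
    "\<And>p q. (p, q) \<in> C \<Longrightarrow> p < q \<and> {p..q} \<subseteq> {a<..<b} \<and> v * (q - p) \<le> f q - f p"
    "disjoint_family_on (\<lambda>(p, q). {p..q}) C"
    "E - (\<Union>(p, q)\<in>C. {p..q}) \<in> null_sets lebesgue"
    using Vitali_intervals[OF fine _ E(2)] by auto
  let ?U = "\<Union>(p, q)\<in>C. {p..q}"
  have U: "?U \<in> sets lebesgue"
    using C(1) by (intro sets.countable_UN'') (auto split: prod.splits)
  have "emeasure lebesgue E \<le> emeasure lebesgue (?U \<union> (E - ?U))"
    using C(4) E U by (intro emeasure_mono) auto
  also have "\<dots> = emeasure lebesgue ?U"
    using C(4) U by (intro emeasure_Un_null_set)
  also have "\<dots> = (\<integral>\<^sup>+i. emeasure lebesgue (case i of (p, q) \<Rightarrow> {p..q}) \<partial>count_space C)"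
    using C by (intro emeasure_UN_countable) (auto split: prod.splits)
  finally have "ennreal v * emeasure lebesgue E \<le>
      (\<integral>\<^sup>+i. ennreal v * emeasure lebesgue (case i of (p, q) \<Rightarrow> {p..q}) \<partial>count_space C)"
    by (simp add: nn_integral_cmult mult_left_mono)
  \<comment> \<open>Increases are measured as lengths of image intervals, taken open because two of
    them may share an end point.\<close>
  also have "\<dots> \<le> (\<integral>\<^sup>+i. emeasure lebesgue (case i of (p, q) \<Rightarrow> {f p<..<f q}) \<partial>count_space C)"
  proof (intro nn_integral_mono)
    fix i assume "i \<in> space (count_space C)"
    then obtain p q where i: "i = (p, q)" "(p, q) \<in> C" by (cases i) auto
    with C(2) have "p < q" "v * (q - p) \<le> f q - f p" by auto
    moreover have "f p \<le> f q"
      using f \<open>p < q\<close> by (simp add: monoD)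
    ultimately show "ennreal v * emeasure lebesgue (case i of (p, q) \<Rightarrow> {p..q})
        \<le> emeasure lebesgue (case i of (p, q) \<Rightarrow> {f p<..<f q})"
      using \<open>0 \<le> v\<close> i by (simp add: ennreal_leI flip: ennreal_mult)
  qed
  also have "\<dots> = emeasure lebesgue (\<Union>(p, q)\<in>C. {f p<..<f q})"
  proof (intro emeasure_UN_countable[symmetric])
    show "disjoint_family_on (\<lambda>(p, q). {f p<..<f q}) C"
      unfolding disjoint_family_on_def
    proof (intro ballI impI)
      fix i j assume ij: "i \<in> C" "j \<in> C" "i \<noteq> j"
      obtain p q p' q' where eq: "i = (p, q)" "j = (p', q')"
        by (cases i, cases j)
      have "{p..q} \<inter> {p'..q'} = {}"
        using disjoint_family_onD[OF C(3) ij] by (simp only: eq prod.case)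
      moreover have "p < q" "p' < q'"
        using ij C(2) eq by auto
      ultimately have "q < p' \<or> q' < p"
        by (auto simp: max_def min_def split: if_splits)
      then have "f q \<le> f p' \<or> f q' \<le> f p"
        using f by (meson less_imp_le monoD)
      then show "(case i of (p, q) \<Rightarrow> {f p<..<f q}) \<inter> (case j of (p, q) \<Rightarrow> {f p<..<f q}) = {}"
        unfolding eq by auto
    qed
  qed (use C in auto)
  also have "\<dots> \<le> emeasure lebesgue {f a..f b}"
  proof (intro emeasure_mono)
    show "(\<Union>(p, q)\<in>C. {f p<..<f q}) \<subseteq> {f a..f b}"
    proof clarify
      fix p q y assume "(p, q) \<in> C" "y \<in> {f p<..<f q}"
      moreover from this C(2)[of p q] have "{p..q} \<subseteq> {a<..<b}" "p \<in> {p..q}" "q \<in> {p..q}"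
        by auto
      then have "p \<in> {a<..<b}" "q \<in> {a<..<b}"
        by blast+
      then have "a \<le> p" "q \<le> b"
        by auto
      then have "f a \<le> f p" "f q \<le> f b"
        using f by (auto dest: monoD)
      ultimately show "y \<in> {f a..f b}" by auto
    qed
  qed auto
  also have "\<dots> = ennreal (f b - f a)"
    using f \<open>a \<le> b\<close> by (simp add: monoD)
  finally show ?thesis .
qed

text \<open>Cover \<open>E\<close> by slow intervals inside an open set barely larger than
  \<open>E\<close>. On each, the increase of \<open>f\<close> is at least \<open>v\<close> times the
  measure of the part of \<open>E\<close> in it and at most \<open>u\<close> times the length.
  Summing bounds \<open>v\<close> times the measure of \<open>E\<close> by \<open>u\<close> times
  that measure plus an arbitrarily small error.\<close>

lemma null_set_two_slopes:
  fixes f :: "real \<Rightarrow> real"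
  assumes f: "mono f" and uv: "0 \<le> u" "u < v"
    and E: "E \<in> sets lebesgue" "bounded E"
    and low: "fine_cover (\<lambda>p q. f q - f p \<le> u * (q - p)) E"
    and high: "fine_cover (\<lambda>p q. v * (q - p) \<le> f q - f p) E"
  shows "E \<in> null_sets lebesgue"
proof -
  have fin: "emeasure lebesgue E < \<infinity>"
    using bounded_set_imp_lmeasurable[OF E(2,1)] by (rule fmeasurableD2[THEN less_top[THEN iffD1], folded infinity_ennreal_def])
  have *: "ennreal v * emeasure lebesgue E \<le> ennreal u * (emeasure lebesgue E + ennreal \<epsilon>)"
    if \<epsilon>: "\<epsilon> > 0" for \<epsilon>
  proof -
    obtain U where U: "open U" "E \<subseteq> U" "U - E \<in> lmeasurable" "emeasure lebesgue (U - E) < ennreal \<epsilon>"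
      using sets_lebesgue_outer_open[OF E(1) \<epsilon>] by metis
    obtain C where C: "countable C"
      "\<And>p q. (p, q) \<in> C \<Longrightarrow> p < q \<and> {p..q} \<subseteq> U \<and> f q - f p \<le> u * (q - p)"
      "disjoint_family_on (\<lambda>(p, q). {p..q}) C"
      "E - (\<Union>(p, q)\<in>C. {p..q}) \<in> null_sets lebesgue"
      using Vitali_intervals[OF low U(1,2)] by blast
    let ?V = "\<Union>(p, q)\<in>C. {p..q}" and ?I = "\<lambda>(p::real, q). {p..q}"
    have V: "?V \<in> sets lebesgue"
      using C(1) by (intro sets.countable_UN'') (auto split: prod.splits)
    have 1: "ennreal v * emeasure lebesgue (E \<inter> ?I i) \<le> ennreal u * emeasure lebesgue (?I i)"
      if "i \<in> C" for i
    proof -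
      obtain p q where i: "i = (p, q)" by force
      with that C(2) have pq: "p < q" "f q - f p \<le> u * (q - p)" by auto
      \<comment> \<open>The slope bound wants the set inside the open interval; the two end points
        are null.\<close>
      have "emeasure lebesgue (E \<inter> {p..q}) \<le> emeasure lebesgue ((E \<inter> {p<..<q}) \<union> {p, q})"
        using E by (intro emeasure_mono sets.Un sets.Int) auto
      also have "\<dots> = emeasure lebesgue (E \<inter> {p<..<q})"
        using E by (intro emeasure_Un_null_set) (auto simp flip: negligible_iff_null_sets)
      finally have "ennreal v * emeasure lebesgue (E \<inter> {p..q})
          \<le> ennreal v * emeasure lebesgue (E \<inter> {p<..<q})"
        by (intro mult_left_mono) auto
      also have "\<dots> \<le> ennreal (f q - f p)"
        using f uv pq E fine_cover_subset[OF high, of "E \<inter> {p<..<q}"]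
        by (intro emeasure_le_fine_cover_slope) auto
      also have "\<dots> \<le> ennreal u * ennreal (q - p)"
        using pq uv by (simp add: ennreal_leI flip: ennreal_mult)
      finally show ?thesis
        using pq i by simp
    qed
    have "emeasure lebesgue E \<le> emeasure lebesgue ((E \<inter> ?V) \<union> (E - ?V))"
      using C(4) E V by (intro emeasure_mono) auto
    also have "\<dots> = emeasure lebesgue (E \<inter> ?V)"
      using C(4) E V by (intro emeasure_Un_null_set) auto
    also have "E \<inter> ?V = (\<Union>i\<in>C. E \<inter> ?I i)"
      by auto
    also have "emeasure lebesgue \<dots> = (\<integral>\<^sup>+i. emeasure lebesgue (E \<inter> ?I i) \<partial>count_space C)"
    proof (intro emeasure_UN_countable)
      show "disjoint_family_on (\<lambda>i. E \<inter> ?I i) C"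
        using C(3) unfolding disjoint_family_on_def by blast
    qed (use C(1) E in \<open>auto split: prod.splits\<close>)
    finally have "ennreal v * emeasure lebesgue E \<le>
        ennreal v * (\<integral>\<^sup>+i. emeasure lebesgue (E \<inter> ?I i) \<partial>count_space C)"
      by (rule mult_left_mono) auto
    also have "\<dots> = (\<integral>\<^sup>+i. ennreal v * emeasure lebesgue (E \<inter> ?I i) \<partial>count_space C)"
      by (simp add: nn_integral_cmult)
    also have "\<dots> \<le> (\<integral>\<^sup>+i. ennreal u * emeasure lebesgue (?I i) \<partial>count_space C)"
      using 1 by (intro nn_integral_mono) auto
    also have "\<dots> = ennreal u * (\<integral>\<^sup>+i. emeasure lebesgue (?I i) \<partial>count_space C)"
      by (simp add: nn_integral_cmult)
    also have "(\<integral>\<^sup>+i. emeasure lebesgue (?I i) \<partial>count_space C) = emeasure lebesgue ?V"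
      using C by (intro emeasure_UN_countable[symmetric]) (auto split: prod.splits)
    also have "emeasure lebesgue ?V \<le> emeasure lebesgue (E \<union> (U - E))"
      using C(2) U E by (intro emeasure_mono) fastforce+
    also have "\<dots> \<le> emeasure lebesgue E + emeasure lebesgue (U - E)"
      using E U by (intro emeasure_subadditive) auto
    also have "\<dots> \<le> emeasure lebesgue E + ennreal \<epsilon>"
      using U(4) by (intro add_left_mono) auto
    finally show ?thesis
      by (simp add: mult_left_mono)
  qed
  define e where "e = measure lebesgue E"
  have e: "emeasure lebesgue E = ennreal e" "e \<ge> 0"
    using fin by (auto simp: e_def emeasure_eq_ennreal_measure)
  have "v * e \<le> u * e + \<epsilon>" if "\<epsilon> > 0" for \<epsilon>
  proof -
    \<comment> \<open>The denominator \<open>u + 1\<close> covers the case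
      \<open>u = 0\<close>.\<close>
    define \<eta> where "\<eta> = \<epsilon> / (u + 1)"
    have \<eta>: "\<eta> > 0"
      using that uv by (simp add: \<eta>_def)
    have "ennreal (v * e) = ennreal v * ennreal e" "ennreal (u * (e + \<eta>)) = ennreal u * (ennreal e + ennreal \<eta>)"
      using uv e(2) \<eta> by (auto simp: ennreal_mult ennreal_plus)
    then have "ennreal (v * e) \<le> ennreal (u * (e + \<eta>))"
      using *[OF \<eta>] e(1) by simp
    then have "v * e \<le> u * (e + \<eta>)"
      by (rule ennreal_le_iff[THEN iffD1, rotated]) (use uv e(2) \<eta> in auto)
    also have "u * \<eta> \<le> (u + 1) * \<eta>"
      using \<eta> by (intro mult_right_mono) auto
    then have "u * (e + \<eta>) \<le> u * e + \<epsilon>"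
      using uv by (simp add: \<eta>_def distrib_left)
    finally show ?thesis .
  qed
  then have "v * e \<le> u * e"
    by (rule field_le_epsilon)
  then have "e = 0"
    using uv e(2) by (auto simp: mult_le_cancel_right)
  then show ?thesis
    using e E by (auto intro!: null_setsI)
qed

text \<open>Where the difference quotients do not converge, rationals \<open>u < v\<close> fit
  strictly between their lower and upper limits. Such points lie in countably many sets
  \<open>E u v N\<close>, each of them null.\<close>

lemma mono_lipschitz_differentiable_ae:
  fixes f :: "real \<Rightarrow> real"
  assumes f: "mono f" and lip: "K-lipschitz_on UNIV f"
  shows "AE x in lebesgue. \<exists>D. DERIV f x :> D"
proof -
  define Q where "Q x h = (f (x + h) - f x) / h" for x h
  have Q: "0 \<le> Q x h" "Q x h \<le> K" if "h \<noteq> 0" for x h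
  proof -
    show "0 \<le> Q x h"
      using that monoD[OF f, of x "x + h"] monoD[OF f, of "x + h" x]
      by (cases "h > 0") (auto simp: Q_def divide_nonpos_neg)
    have "\<bar>Q x h\<bar> \<le> K"
      using that lipschitz_onD[OF lip, of "x + h" x]
      by (simp add: Q_def abs_divide dist_real_def divide_le_eq)
    then show "Q x h \<le> K" by simp
  qed
  have cont: "continuous_on UNIV f"
    using lip by (rule lipschitz_on_continuous_on)
  define G where "G u d = {x. \<exists>h. h \<noteq> 0 \<and> \<bar>h\<bar> < d \<and> Q x h < u}" for u d :: real
  define H where "H v d = {x. \<exists>h. h \<noteq> 0 \<and> \<bar>h\<bar> < d \<and> v < Q x h}" for v d :: real
  have cQ: "continuous_on UNIV (\<lambda>x. Q x h)" for h
    unfolding Q_def divide_inverse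
    by (intro continuous_intros continuous_on_compose2[OF cont] cont) auto
  have "G u d = (\<Union>h\<in>{h. h \<noteq> 0 \<and> \<bar>h\<bar> < d}. {x. Q x h < u})"
       "H u d = (\<Union>h\<in>{h. h \<noteq> 0 \<and> \<bar>h\<bar> < d}. {x. u < Q x h})" for u d
    by (auto simp: G_def H_def)
  then have GH: "open (G u d)" "open (H u d)" for u d
    by (auto intro!: open_UN open_Collect_less cQ continuous_intros)
  \<comment> \<open>\<open>G\<close> and \<open>H\<close> are open, so this is a Borel set; the ball
    makes it bounded.\<close>
  define E where "E u v N = (\<Inter>n. G u (1 / real (Suc n)) \<inter> H v (1 / real (Suc n))) \<inter> ball 0 (real N)"
    for u v N
  have null: "E u v N \<in> null_sets lebesgue" if "u < v" for u v N
  \<comment> \<open>Difference quotients of a monotone function are never negative, so the set is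
    empty for \<open>u \<le> 0\<close>.\<close>
  proof (cases "u > 0")
    case True
    have ex: "\<exists>h. h \<noteq> 0 \<and> \<bar>h\<bar> < d \<and> Q x h < u" "\<exists>h. h \<noteq> 0 \<and> \<bar>h\<bar> < d \<and> v < Q x h"
      if x: "x \<in> E u v N" and d: "d > 0" for x d
    proof -
      obtain n where "1 / real (Suc n) < d"
        using d nat_approx_posE by metis
      moreover have "x \<in> G u (1 / real (Suc n))" "x \<in> H v (1 / real (Suc n))"
        using x by (auto simp: E_def)
      ultimately show "\<exists>h. h \<noteq> 0 \<and> \<bar>h\<bar> < d \<and> Q x h < u" "\<exists>h. h \<noteq> 0 \<and> \<bar>h\<bar> < d \<and> v < Q x h"
        unfolding G_def H_def by (auto intro: less_trans)
    qed
    have step: "\<exists>p q. p < q \<and> q - p < d \<and> p \<le> x \<and> x \<le> q \<and> (f q - f p) / (q - p) = Q x h"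
      if "h \<noteq> 0" "\<bar>h\<bar> < d" for x d h
    proof (cases "h > 0")
      case True
      with that show ?thesis
        by (intro exI[of _ x] exI[of _ "x + h"]) (auto simp: Q_def)
    next
      case False
      with that show ?thesis
        by (intro exI[of _ "x + h"] exI[of _ x]) (auto simp: Q_def field_simps)
    qed
    show ?thesis
    proof (rule null_set_two_slopes[OF f])
      show "fine_cover (\<lambda>p q. f q - f p \<le> u * (q - p)) (E u v N)"
        unfolding fine_cover_def
      proof (intro ballI allI impI)
        fix x d :: real assume "x \<in> E u v N" "d > 0"
        from ex(1)[OF this] step obtain p q
          where "p < q" "q - p < d" "p \<le> x" "x \<le> q" "(f q - f p) / (q - p) < u"
          by metis
        then show "\<exists>p q. p < q \<and> q - p < d \<and> p \<le> x \<and> x \<le> q \<and> f q - f p \<le> u * (q - p)"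
          by (intro exI[of _ p] exI[of _ q]) (auto simp: divide_less_eq)
      qed
      show "fine_cover (\<lambda>p q. v * (q - p) \<le> f q - f p) (E u v N)"
        unfolding fine_cover_def
      proof (intro ballI allI impI)
        fix x d :: real assume "x \<in> E u v N" "d > 0"
        from ex(2)[OF this] step obtain p q
          where "p < q" "q - p < d" "p \<le> x" "x \<le> q" "v < (f q - f p) / (q - p)"
          by metis
        then show "\<exists>p q. p < q \<and> q - p < d \<and> p \<le> x \<and> x \<le> q \<and> v * (q - p) \<le> f q - f p"
          by (intro exI[of _ p] exI[of _ q]) (auto simp: less_divide_eq)
      qed
      have "E u v N \<in> sets borel"
        unfolding E_def using GH by (intro sets.Int sets.countable_INT'') auto
      then show "E u v N \<in> sets lebesgue" by simp
      show "bounded (E u v N)"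
        unfolding E_def by (rule bounded_subset[OF bounded_ball]) auto
    qed (use that True in auto)
  next
    case False
    have "E u v N \<subseteq> (\<Inter>n. G u (1 / real (Suc n)))"
      by (auto simp: E_def)
    also have "\<dots> \<subseteq> G u (1 / real (Suc 0))"
      by (rule INF_lower) simp
    also have "\<dots> = {}"
    proof -
      have "\<not> Q x h < u" if "h \<noteq> 0" for x h
        using Q(1)[OF that, of x] False by linarith
      then show ?thesis
        unfolding G_def by blast
    qed
    finally have "E u v N = {}" by blast
    then show ?thesis by simp
  qed
  define I :: "(real \<times> real \<times> nat) set" where "I = {(u, v, N). u \<in> \<rat> \<and> v \<in> \<rat> \<and> u < v}"
  have "countable I"
  proof (rule countable_subset)
    show "I \<subseteq> \<rat> \<times> \<rat> \<times> UNIV"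
      by (auto simp: I_def)
  qed (auto intro: countable_rat)
  moreover have "AE x in lebesgue. x \<notin> (case i of (u, v, N) \<Rightarrow> E u v N)" if "i \<in> I" for i
  proof -
    have "(case i of (u, v, N) \<Rightarrow> E u v N) \<in> null_sets lebesgue"
      using that null by (auto simp: I_def)
    then show ?thesis by (rule AE_not_in)
  qed
  ultimately have "AE x in lebesgue. \<forall>i\<in>I. x \<notin> (case i of (u, v, N) \<Rightarrow> E u v N)"
    by (intro AE_ball_countable')
  then show ?thesis
  proof (rule AE_mp, intro AE_I2 impI)
    fix x :: real
    assume *: "\<forall>i\<in>I. x \<notin> (case i of (u, v, N) \<Rightarrow> E u v N)"
    have dich: "(\<forall>\<^sub>F h in at 0. u \<le> Q x h) \<or> (\<forall>\<^sub>F h in at 0. Q x h \<le> v)"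
      if uv: "u \<in> \<rat>" "v \<in> \<rat>" "u < v" for u v
    proof -
      obtain N where "\<bar>x\<bar> < real N"
        using reals_Archimedean2 by blast
      moreover have "x \<notin> E u v N"
        using * uv by (auto simp: I_def)
      ultimately obtain n where "x \<notin> G u (1 / real (Suc n)) \<or> x \<notin> H v (1 / real (Suc n))"
        by (auto simp: E_def)
      then have "(\<forall>h. h \<noteq> 0 \<and> \<bar>h\<bar> < 1 / real (Suc n) \<longrightarrow> u \<le> Q x h) \<or>
          (\<forall>h. h \<noteq> 0 \<and> \<bar>h\<bar> < 1 / real (Suc n) \<longrightarrow> Q x h \<le> v)"
        by (auto simp: G_def H_def not_less)
      moreover have "0 < 1 / real (Suc n)"
        by simp
      ultimately show ?thesis
        unfolding eventually_at dist_real_def diff_zero by blast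
    qed
    \<comment> \<open>\<open>Sup S\<close> is the lower limit of the quotients. A rational above it
      is not in \<open>S\<close>, so \<open>dich\<close> bounds the quotients from above.\<close>
    define S where "S = {u. \<forall>\<^sub>F h in at 0. u \<le> Q x h}"
    have "0 \<in> S"
      using Q(1) by (auto simp: S_def eventually_at_filter)
    have bdd: "u \<le> K" if "u \<in> S" for u
    proof -
      have "\<forall>\<^sub>F h in at 0. u \<le> Q x h" "\<forall>\<^sub>F h in at (0::real). h \<noteq> 0"
        using that by (auto simp: S_def eventually_at_filter)
      then have "\<forall>\<^sub>F h in at (0::real). u \<le> K"
      proof eventually_elim
        case (elim h)
        then show ?case using Q(2)[of h x] by linarith
      qed
      then show ?thesis by simp
    qed
    have "(Q x \<longlongrightarrow> Sup S) (at 0)"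
    proof (rule order_tendstoI)
      fix w assume "w < Sup S"
      then obtain u where "u \<in> S" "w < u"
        using \<open>0 \<in> S\<close> less_cSup_iff[of S w] bdd by (auto simp: bdd_above_def)
      then show "\<forall>\<^sub>F h in at 0. w < Q x h"
        by (auto simp: S_def elim!: eventually_mono)
    next
      fix w assume "Sup S < w"
      then obtain v where v: "v \<in> \<rat>" "Sup S < v" "v < w"
        using Rats_dense_in_real by blast
      then obtain u where u: "u \<in> \<rat>" "Sup S < u" "u < v"
        using Rats_dense_in_real by blast
      have "u \<notin> S"
        using u(2) bdd cSup_upper[of u S] by (auto simp: bdd_above_def)
      then have "\<forall>\<^sub>F h in at 0. Q x h \<le> v"
        using dich[OF u(1) v(1) u(3)] by (auto simp: S_def)
      then show "\<forall>\<^sub>F h in at 0. Q x h < w"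
        using v(3) by (auto elim!: eventually_mono)
    qed
    then show "\<exists>D. DERIV f x :> D"
      unfolding Q_def DERIV_def by blast
  qed
qed

text \<open>Adding \<open>K * s\<close> makes each component monotone and keeps it
  Lipschitz.\<close>

lemma lipschitz_has_vector_derivative_ae:
  fixes f :: "real \<Rightarrow> 'a::euclidean_space"
  assumes lip: "K-lipschitz_on UNIV f"
  shows "AE x in lebesgue. \<exists>D. (f has_vector_derivative D) (at x)"
proof -
  have K: "K \<ge> 0"
    using lip by (rule lipschitz_on_nonneg)
  have "AE x in lebesgue. \<exists>D. DERIV (\<lambda>s. f s \<bullet> i + K * s) x :> D" if i: "i \<in> Basis" for i
  proof (rule mono_lipschitz_differentiable_ae)
    have comp: "\<bar>f y \<bullet> i - f x \<bullet> i\<bar> \<le> K * \<bar>y - x\<bar>" for x y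
    proof -
      have "\<bar>f y \<bullet> i - f x \<bullet> i\<bar> \<le> norm (f y - f x)"
        using Basis_le_norm[OF i, of "f y - f x"] by (simp add: inner_diff_left)
      also have "\<dots> \<le> K * \<bar>y - x\<bar>"
        using lipschitz_onD[OF lip, of y x] by (simp add: dist_norm)
      finally show ?thesis .
    qed
    show "mono (\<lambda>s. f s \<bullet> i + K * s)"
    proof (rule monoI)
      fix x y :: real assume "x \<le> y"
      then show "f x \<bullet> i + K * x \<le> f y \<bullet> i + K * y"
        using comp[of y x] by (simp add: algebra_simps abs_le_iff)
    qed
    show "(K + K)-lipschitz_on UNIV (\<lambda>s. f s \<bullet> i + K * s)"
    proof (rule lipschitz_on_add)
      show "K-lipschitz_on UNIV (\<lambda>s. f s \<bullet> i)"
        using comp K by (intro lipschitz_onI) (auto simp: dist_real_def)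
      show "K-lipschitz_on UNIV (\<lambda>s. K * s)"
        using K by (intro lipschitz_onI) (auto simp: dist_real_def abs_mult simp flip: right_diff_distrib)
    qed
  qed
  then have "AE x in lebesgue. \<forall>i\<in>Basis. \<exists>D. DERIV (\<lambda>s. f s \<bullet> i + K * s) x :> D"
    by (intro AE_finite_allI) auto
  then show ?thesis
  proof (rule AE_mp, intro AE_I2 impI)
    fix x assume "\<forall>i\<in>Basis. \<exists>D. DERIV (\<lambda>s. f s \<bullet> i + K * s) x :> D"
    then obtain D where D: "\<And>i. i \<in> Basis \<Longrightarrow> DERIV (\<lambda>s. f s \<bullet> i + K * s) x :> D i"
      by metis
    have "((\<lambda>s. f s \<bullet> i) has_vector_derivative (D i - K)) (at x)" if "i \<in> Basis" for i
    proof -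
      have "DERIV (\<lambda>s. (f s \<bullet> i + K * s) - K * s) x :> D i - K"
        using DERIV_diff[OF D[OF that] DERIV_cmult_Id[of K]] by simp
      then show ?thesis
        by (simp add: has_real_derivative_iff_has_vector_derivative)
    qed
    then have "(f has_vector_derivative (\<Sum>i\<in>Basis. (D i - K) *\<^sub>R i)) (at x)"
      unfolding has_vector_derivative_def has_derivative_componentwise_within[of f]
      by (auto simp: inner_sum_left_Basis)
    then show "\<exists>D. (f has_vector_derivative D) (at x)" ..
  qed
qed

section \<open>Exterior disks, tangents and normals\<close>

lemma tangent_cone_mono: "K \<subseteq> K' \<Longrightarrow> tangent_cone K q \<subseteq> tangent_cone K' q"
  unfolding tangent_cone_def by blast

lemma normal_cone_scaleR: "u \<in> normal_cone K q \<Longrightarrow> 0 \<le> r \<Longrightarrow> r *\<^sub>R u \<in> normal_cone K q"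
  by (auto simp: normal_cone_def mult_nonneg_nonpos)

text \<open>For \<open>y\<close> outside the disk, \<open>l \<bullet> (y - q)\<close> is at most the
  squared distance of \<open>y\<close> and \<open>q\<close> divided by \<open>2 * R\<close>. This is
  of second order and vanishes in the limit of directions.\<close>

lemma exterior_ball_imp_normal:
  assumes "R > 0" "norm l = 1" "K \<inter> ball (q + R *\<^sub>R l) R = {}"
  shows "l \<in> normal_cone K q"
  unfolding normal_cone_def
proof clarify
  fix w assume w: "w \<in> tangent_cone K q"
  \<comment> \<open>The summand 1 accounts for replacing \<open>w\<close> by its approximation, the
    fraction for the quadratic term.\<close>
  define M where "M = 1 + (norm w + 1) / (2 * R)"
  have "M > 0"
    using assms(1) by (auto simp: M_def intro: add_pos_nonneg)
  have *: "l \<bullet> w \<le> \<epsilon> * M" if "0 < \<epsilon>" "\<epsilon> < 1" for \<epsilon>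
  proof -
    obtain y r where y: "y \<in> K" "r > 0" "norm (y - q) < \<epsilon>" "norm (r *\<^sub>R (y - q) - w) < \<epsilon>"
      using w \<open>0 < \<epsilon>\<close> unfolding tangent_cone_def by blast
    have "R \<le> norm ((y - q) - R *\<^sub>R l)"
      using assms(3) y(1) by (auto simp: dist_norm norm_minus_commute algebra_simps disjoint_iff not_less)
    then have "R\<^sup>2 \<le> (norm ((y - q) - R *\<^sub>R l))\<^sup>2"
      using assms(1) by (intro power_mono) auto
    also have "\<dots> = (norm (y - q))\<^sup>2 - 2 * (R * (l \<bullet> (y - q))) + R\<^sup>2"
      using assms(2) unfolding power2_norm_eq_inner
      by (simp add: inner_diff_left inner_diff_right inner_commute norm_eq_1 power2_eq_square algebra_simps)
    finally have "2 * (R * (l \<bullet> (y - q))) \<le> (norm (y - q))\<^sup>2"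
      by simp
    then have "l \<bullet> (y - q) \<le> (norm (y - q))\<^sup>2 / (2 * R)"
      using assms(1) by (simp add: field_simps)
    then have "r * (l \<bullet> (y - q)) \<le> r * ((norm (y - q))\<^sup>2 / (2 * R))"
      using y(2) by (intro mult_left_mono) auto
    also have "\<dots> = norm (r *\<^sub>R (y - q)) * norm (y - q) / (2 * R)"
      using y(2) by (simp add: power2_eq_square)
    also have "\<dots> \<le> (norm w + 1) * \<epsilon> / (2 * R)"
    proof -
      have "norm (r *\<^sub>R (y - q)) \<le> norm w + 1"
        using norm_triangle_sub[of "r *\<^sub>R (y - q)" w] y(4) \<open>\<epsilon> < 1\<close> by linarith
      then show ?thesis
        using y(3) assms(1) by (intro divide_right_mono mult_mono) auto
    qed
    finally have "l \<bullet> (r *\<^sub>R (y - q)) \<le> (norm w + 1) * \<epsilon> / (2 * R)"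
      by simp
    moreover have "l \<bullet> (w - r *\<^sub>R (y - q)) \<le> \<epsilon>"
      using norm_cauchy_schwarz[of l "w - r *\<^sub>R (y - q)"] assms(2) y(4)
      by (simp add: norm_minus_commute)
    ultimately show ?thesis
      by (simp add: M_def inner_diff_right distrib_left mult.commute)
  qed
  show "l \<bullet> w \<le> 0"
  proof (rule ccontr)
    assume "\<not> l \<bullet> w \<le> 0"
    define \<epsilon> where "\<epsilon> = min (1 / 2) (l \<bullet> w / (2 * M))"
    have "0 < \<epsilon>" "\<epsilon> < 1"
      using \<open>\<not> l \<bullet> w \<le> 0\<close> \<open>M > 0\<close> by (auto simp: \<epsilon>_def)
    then have "l \<bullet> w \<le> \<epsilon> * M"
      by (rule *)
    also have "\<dots> \<le> l \<bullet> w / (2 * M) * M"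
      using \<open>M > 0\<close> by (intro mult_right_mono) (auto simp: \<epsilon>_def)
    also have "\<dots> = l \<bullet> w / 2"
      using \<open>M > 0\<close> by simp
    finally show False
      using \<open>\<not> l \<bullet> w \<le> 0\<close> by simp
  qed
qed

lemma exterior_ball_imp_frontier:
  fixes K :: "'a::real_normed_vector set"
  assumes "R > 0" "norm l = 1" "K \<inter> ball (q + R *\<^sub>R l) R = {}" "q \<in> K"
  shows "q \<in> frontier K"
proof -
  have "q \<notin> interior K"
  proof
    assume "q \<in> interior K"
    then obtain e where e: "e > 0" "ball q e \<subseteq> K"
      by (auto simp: mem_interior)
    define \<eta> where "\<eta> = min (e / 2) R"
    have \<eta>: "0 < \<eta>" "\<eta> < e" "\<eta> \<le> R"
      using e assms by (auto simp: \<eta>_def)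
    have "q + \<eta> *\<^sub>R l \<in> ball q e"
      using \<eta> assms by (simp add: dist_norm)
    moreover have "q + R *\<^sub>R l - (q + \<eta> *\<^sub>R l) = (R - \<eta>) *\<^sub>R l"
      by (simp add: algebra_simps)
    then have "q + \<eta> *\<^sub>R l \<in> ball (q + R *\<^sub>R l) R"
      using \<eta> assms by (simp add: dist_norm)
    ultimately show False
      using e assms by blast
  qed
  with assms(4) show ?thesis
    unfolding frontier_def using closure_subset by blast
qed

text \<open>The set accumulates at \<open>q\<close>, and normalised secants have a convergent
  subsequence because the unit circle is compact.\<close>

lemma connected_unit_tangent:
  assumes "connected S" "q \<in> S" "S \<noteq> {q}"
  shows "\<exists>l\<in>tangent_cone S q. norm l = 1"
proof -
  have "q islimpt S"
    using assms connected_imp_perfect[of S q] by blast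
  then obtain y where y: "\<And>n::nat. y n \<in> S - {q}" "y \<longlonglongrightarrow> q"
    unfolding islimpt_sequential by blast
  define u where "u n = (y n - q) /\<^sub>R norm (y n - q)" for n
  have "norm (u n) = 1" for n
    using y(1)[of n] by (simp add: u_def)
  then have "\<forall>n. u n \<in> sphere 0 1"
    by simp
  then obtain l \<phi> where l: "l \<in> sphere 0 1" "strict_mono \<phi>" "(u \<circ> \<phi>) \<longlonglongrightarrow> l"
    using compact_sphere[of "0::real^2" 1] unfolding compact_def by meson
  have "l \<in> tangent_cone S q"
    unfolding tangent_cone_def
  proof (intro CollectI allI impI)
    fix \<epsilon> :: real assume "\<epsilon> > 0"
    have "\<forall>\<^sub>F n in sequentially. dist ((y \<circ> \<phi>) n) q < \<epsilon>" "\<forall>\<^sub>F n in sequentially. dist ((u \<circ> \<phi>) n) l < \<epsilon>"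
      using tendstoD[OF LIMSEQ_subseq_LIMSEQ[OF y(2) l(2)] \<open>\<epsilon> > 0\<close>] tendstoD[OF l(3) \<open>\<epsilon> > 0\<close>] by auto
    then have "\<forall>\<^sub>F n in sequentially. dist ((y \<circ> \<phi>) n) q < \<epsilon> \<and> dist ((u \<circ> \<phi>) n) l < \<epsilon>"
      by (rule eventually_conj)
    then obtain n where n: "dist (y (\<phi> n)) q < \<epsilon>" "dist (u (\<phi> n)) l < \<epsilon>"
      by (auto dest: eventually_happens)
    show "\<exists>x\<in>S. \<exists>r>0. norm (x - q) < \<epsilon> \<and> norm (r *\<^sub>R (x - q) - l) < \<epsilon>"
      using n y(1)[of "\<phi> n"]
      by (intro bexI[of _ "y (\<phi> n)"] exI[of _ "inverse (norm (y (\<phi> n) - q))"])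
        (auto simp: dist_norm u_def)
  qed
  with l(1) show ?thesis
    by auto
qed

lemma vector_derivative_imp_tangent:
  fixes x :: "real \<Rightarrow> real^2"
  assumes der: "(x has_vector_derivative v) (at s within {a..b})" and "a \<le> s" "s < b" "v \<noteq> 0"
  shows "v /\<^sub>R norm v \<in> tangent_cone (x ` {s..b}) (x s)"
  unfolding tangent_cone_def
proof (intro CollectI allI impI)
  fix \<epsilon> :: real assume "\<epsilon> > 0"
  define e where "e = \<epsilon> * norm v / 2"
  have "e > 0"
    using \<open>\<epsilon> > 0\<close> \<open>v \<noteq> 0\<close> by (simp add: e_def)
  then obtain d where d: "d > 0"
    "\<And>y. y \<in> {a..b} \<Longrightarrow> \<bar>y - s\<bar> < d \<Longrightarrow> norm (x y - x s - (y - s) *\<^sub>R v) \<le> e * \<bar>y - s\<bar>"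
    using der unfolding has_vector_derivative_def has_derivative_within_alt by fastforce
  \<comment> \<open>Small enough for the derivative estimate, for staying in the interval, and for
    \<open>x (s + h)\<close> to be within \<open>\<epsilon> / 2\<close> of
    \<open>x s\<close>.\<close>
  define h where "h = min (d / 2) (min (b - s) (\<epsilon> / (2 * (e + norm v))))"
  have h: "0 < h" "h < d" "h \<le> b - s" "h \<le> \<epsilon> / (2 * (e + norm v))"
    using d(1) \<open>e > 0\<close> \<open>\<epsilon> > 0\<close> \<open>s < b\<close> by (auto simp: h_def intro!: divide_pos_pos add_pos_nonneg)
  have est: "norm (x (s + h) - x s - h *\<^sub>R v) \<le> e * h"
    using d(2)[of "s + h"] h assms(2) by auto
  have "norm (x (s + h) - x s) \<le> norm (x (s + h) - x s - h *\<^sub>R v) + norm (h *\<^sub>R v)"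
    by (metis norm_triangle_sub add.commute)
  also have "\<dots> \<le> (e + norm v) * h"
    using est h(1) by (simp add: algebra_simps)
  also have "\<dots> \<le> (e + norm v) * (\<epsilon> / (2 * (e + norm v)))"
    using h(4) \<open>e > 0\<close> by (intro mult_left_mono) auto
  also have "\<dots> = \<epsilon> / 2"
  proof -
    have "e + norm v \<noteq> 0"
      using \<open>e > 0\<close> norm_ge_zero[of v] by linarith
    moreover have "m * (\<epsilon> / (2 * m)) = \<epsilon> / 2" if "m \<noteq> 0" for m
      using that by simp
    ultimately show ?thesis by blast
  qed
  also have "\<dots> < \<epsilon>"
    using \<open>\<epsilon> > 0\<close> by simp
  finally have 1: "norm (x (s + h) - x s) < \<epsilon>" .
  define r where "r = inverse (h * norm v)"
  have "r > 0"
    using h(1) \<open>v \<noteq> 0\<close> by (simp add: r_def)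
  have "r *\<^sub>R (x (s + h) - x s) - v /\<^sub>R norm v = r *\<^sub>R (x (s + h) - x s - h *\<^sub>R v)"
    using h(1) \<open>v \<noteq> 0\<close> by (simp add: r_def algebra_simps)
  then have "norm (r *\<^sub>R (x (s + h) - x s) - v /\<^sub>R norm v) = r * norm (x (s + h) - x s - h *\<^sub>R v)"
    using \<open>r > 0\<close> by simp
  also have "\<dots> \<le> r * (e * h)"
    using est \<open>r > 0\<close> by (intro mult_left_mono) auto
  also have "\<dots> = \<epsilon> / 2"
    using h(1) \<open>v \<noteq> 0\<close> by (simp add: r_def e_def field_simps)
  also have "\<dots> < \<epsilon>"
    using \<open>\<epsilon> > 0\<close> by simp
  finally have 2: "norm (r *\<^sub>R (x (s + h) - x s) - v /\<^sub>R norm v) < \<epsilon>" .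
  show "\<exists>y\<in>x ` {s..b}. \<exists>r>0. norm (y - x s) < \<epsilon> \<and> norm (r *\<^sub>R (y - x s) - v /\<^sub>R norm v) < \<epsilon>"
    using 1 2 \<open>r > 0\<close> h by (intro bexI[of _ "x (s + h)"]) auto
qed

section \<open>The nested family of hulls along the curve\<close>

theorem theorem5p6:
  fixes R a b L :: real and g x :: "real \<Rightarrow> real^2" and c :: "real^2"
  assumes "R > 0"
    and "R_path R a b g"
    and "g ` {a..b} \<subseteq> ball c R"
    and "arc_length_representation a b g L x"
  shows "\<exists>\<Omega> :: real \<Rightarrow> (real^2) set.
           (\<forall>s\<in>{0..L}. closed (\<Omega> s)) \<and>
           (\<forall>s1\<in>{0..L}. \<forall>s2\<in>{0..L}. s1 < s2 \<longrightarrow> \<Omega> s1 \<subseteq> \<Omega> s2) \<and>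
           (\<forall>s\<in>{0..L}. reach (\<Omega> s) \<ge> ereal R) \<and>
           (\<forall>s\<in>{0..L}. x s \<in> frontier (\<Omega> s)) \<and>
           (AE s in lebesgue_on {0..L}.
              \<exists>v. (x has_vector_derivative v) (at s within {0..L}) \<and> v \<in> normal_cone (\<Omega> s) (x s))"
proof -
  have ab: "a < b" and cont: "continuous_on {a..b} g" and gab: "g a \<noteq> g b"
    and path: "\<And>t l. t \<in> {a..b} \<Longrightarrow> l \<in> uminus ` tangent_cone (g ` {a..t}) (g t) \<union> tangent_cone (g ` {t..b}) (g t) \<Longrightarrow>
        norm l = 1 \<Longrightarrow> g ` {a..t} \<inter> ball (g t + R *\<^sub>R l) R = {}"
    using assms(2) unfolding R_path_def by blast+
  have ab': "a \<le> b" using ab by simp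
  define \<sigma> where "\<sigma> t = real_of_ereal (curve_length g a t)" for t
  have len: "curve_length g a b = ereal L" and x: "\<And>t. t \<in> {a..b} \<Longrightarrow> x (\<sigma> t) = g t"
    using assms(4) unfolding arc_length_representation_def \<sigma>_def by auto
  have \<sigma>_mono: "\<sigma> t \<le> \<sigma> t'" if "a \<le> t" "t \<le> t'" "t' \<le> b" for t t'
    unfolding \<sigma>_def using curve_length_real_mono[OF ab' cont len that] .
  have \<sigma>0: "\<sigma> a = 0" and \<sigma>L: "\<sigma> b = L"
    using len by (auto simp: \<sigma>_def)
  then have "0 \<le> L"
    using \<sigma>_mono[of a b] ab' by simp
  have "\<forall>s\<in>{0..L}. \<exists>t\<in>{a..b}. \<sigma> t = s"
    unfolding \<sigma>_def using curve_length_onto[OF ab' cont len] by simp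
  \<comment> \<open>\<open>T s\<close> is one of possibly many parameters with elapsed length
    \<open>s\<close>; \<open>g\<close> is constant on the set of these.\<close>
  then obtain T where T: "\<And>s. s \<in> {0..L} \<Longrightarrow> T s \<in> {a..b}" "\<And>s. s \<in> {0..L} \<Longrightarrow> \<sigma> (T s) = s"
    by metis
  have xT: "x s = g (T s)" if "s \<in> {0..L}" for s
    using x[OF T(1)[OF that]] T(2)[OF that] by simp
  have past: "x ` {0..s} = g ` {a..T s}" if s: "s \<in> {0..L}" for s
  proof (intro equalityI subsetI)
    fix y assume "y \<in> x ` {0..s}"
    then obtain s' where s': "s' \<in> {0..s}" "y = x s'" by blast
    then have "s' \<in> {0..L}" using s by simp
    show "y \<in> g ` {a..T s}"
    proof (cases "T s' \<le> T s")
      case True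
      then show ?thesis
        using s' T(1)[OF \<open>s' \<in> {0..L}\<close>] xT[OF \<open>s' \<in> {0..L}\<close>] by auto
    next
      case False
      \<comment> \<open>\<open>T s < T s'\<close> gives \<open>s \<le> s'\<close> by monotonicity,
        while \<open>s' \<le> s\<close> by choice.\<close>
      then have "s' = s"
        using \<sigma>_mono[of "T s" "T s'"] T(1)[OF \<open>s' \<in> {0..L}\<close>] T(1)[OF s]
          T(2)[OF \<open>s' \<in> {0..L}\<close>] T(2)[OF s] s' by auto
      then show ?thesis
        using s' xT[OF s] T(1)[OF s] by auto
    qed
  next
    fix y assume "y \<in> g ` {a..T s}"
    then obtain t where t: "t \<in> {a..T s}" "y = g t" by blast
    then have "\<sigma> t \<in> {0..s}"
      using \<sigma>_mono[of a t] \<sigma>_mono[of t "T s"] T[OF s] \<sigma>0 by auto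
    then show "y \<in> x ` {0..s}"
      using x[of t] t T(1)[OF s] by force
  qed
  have future: "x ` {s..L} \<subseteq> g ` {T s..b}" if s: "s \<in> {0..L}" for s
  proof
    fix y assume "y \<in> x ` {s..L}"
    then obtain s' where s': "s' \<in> {s..L}" "y = x s'" by blast
    then have "s' \<in> {0..L}" using s by simp
    show "y \<in> g ` {T s..b}"
    proof (cases "T s \<le> T s'")
      case True
      then show ?thesis
        using s' T(1)[OF \<open>s' \<in> {0..L}\<close>] xT[OF \<open>s' \<in> {0..L}\<close>] by auto
    next
      case False
      then have "s' = s"
        using \<sigma>_mono[of "T s'" "T s"] T(1)[OF \<open>s' \<in> {0..L}\<close>] T(1)[OF s]
          T(2)[OF \<open>s' \<in> {0..L}\<close>] T(2)[OF s] s' by auto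
      then show ?thesis
        using s' xT[OF s] T(1)[OF s] by auto
    qed
  qed
  have lip: "dist (x s) (x s') \<le> \<bar>s - s'\<bar>" if "s \<in> {0..L}" "s' \<in> {0..L}" for s s'
  proof -
    have "dist (g t) (g t') \<le> \<bar>\<sigma> t - \<sigma> t'\<bar>" if "t \<in> {a..b}" "t' \<in> {a..b}" for t t'
      using dist_le_curve_length_diff[OF ab' cont len, of t t'] that
        dist_le_curve_length_diff[OF ab' cont len, of t' t]
      by (cases "t \<le> t'") (auto simp: \<sigma>_def dist_commute)
    from this[OF T(1) T(1), OF that] show ?thesis
      using that by (simp add: T(2) xT)
  qed
  define \<Omega> where "\<Omega> s = R_hull R (x ` {0..s})" for s
  have exterior: "\<Omega> s \<inter> ball (x s + R *\<^sub>R l) R = {}"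
    if "s \<in> {0..L}" "l \<in> uminus ` tangent_cone (g ` {a..T s}) (g (T s)) \<union> tangent_cone (g ` {T s..b}) (g (T s))"
      "norm l = 1" for s l
    unfolding \<Omega>_def using path[OF T(1)[OF that(1)] that(2,3)] past[OF that(1)] xT[OF that(1)]
    by (intro R_hull_disjoint) simp
  have conn: "connected (g ` {u..v})" if "a \<le> u" "v \<le> b" for u v
    using that by (intro connected_continuous_image continuous_on_subset[OF cont]) auto

  \<comment> \<open>Compactness leaves a gap between the curve and the boundary of the given disk;
    the reach bound asks for \<open>r < R\<close>.\<close>
  obtain r where r: "0 \<le> r" "r < R" "g ` {a..b} \<subseteq> cball c r"
  proof -
    have "compact (g ` {a..b})" "g ` {a..b} \<noteq> {}"
      using cont ab' by (auto intro: compact_continuous_image)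
    then obtain y where y: "y \<in> g ` {a..b}" "\<forall>z\<in>g ` {a..b}. dist c z \<le> dist c y"
      using distance_attains_sup by metis
    show ?thesis
    proof (rule that)
      show "dist c y < R"
        using y(1) assms(3) by auto
      show "g ` {a..b} \<subseteq> cball c (dist c y)"
        using y(2) by auto
    qed simp
  qed

  show ?thesis
  proof (intro exI[of _ \<Omega>] conjI ballI impI)
    show "closed (\<Omega> s)" for s
      unfolding \<Omega>_def by (rule closed_R_hull)
    show "\<Omega> s1 \<subseteq> \<Omega> s2" if "s1 < s2" for s1 s2
      unfolding \<Omega>_def using that by (intro R_hull_mono image_mono) auto
    show "ereal R \<le> reach (\<Omega> s)" if s: "s \<in> {0..L}" for s
      unfolding \<Omega>_def past[OF s]
    proof (rule reach_R_hull[OF _ _ r(1,2)])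
      show "connected (g ` {a..T s})"
        using T(1)[OF s] by (intro conn) auto
      have "g ` {a..T s} \<subseteq> g ` {a..b}"
        using T(1)[OF s] by (intro image_mono) auto
      with r(3) show "g ` {a..T s} \<subseteq> cball c r"
        by blast
    qed
    show "x s \<in> frontier (\<Omega> s)" if s: "s \<in> {0..L}" for s
    proof -
      have Ts: "a \<le> T s" "T s \<le> b"
        using T(1)[OF s] by auto
      \<comment> \<open>The past provides a direction unless it is a single point. Then
        \<open>g (T s) = g a\<close> differs from \<open>g b\<close>, and the future provides
        one.\<close>
      have "\<exists>l \<in> uminus ` tangent_cone (g ` {a..T s}) (g (T s)) \<union> tangent_cone (g ` {T s..b}) (g (T s)). norm l = 1"
      proof (cases "g ` {a..T s} = {g (T s)}")
        case False
        then obtain l where "l \<in> tangent_cone (g ` {a..T s}) (g (T s))" "norm l = 1"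
          using connected_unit_tangent[OF conn[of a "T s"], of "g (T s)"] Ts by auto
        then show ?thesis
          by (intro bexI[of _ "- l"]) auto
      next
        case True
        then have "g a = g (T s)"
          using Ts by auto
        then have "g ` {T s..b} \<noteq> {g (T s)}"
          using gab Ts by (metis atLeastAtMost_iff image_eqI order_refl singletonD)
        then show ?thesis
          using connected_unit_tangent[OF conn[of "T s" b], of "g (T s)"] Ts by auto
      qed
      then obtain l where "norm l = 1" "\<Omega> s \<inter> ball (x s + R *\<^sub>R l) R = {}"
        using exterior[OF s] by blast
      moreover have "x s \<in> \<Omega> s"
        unfolding \<Omega>_def using s by (intro subsetD[OF subset_R_hull]) auto
      ultimately show ?thesis
        using \<open>R > 0\<close> by (intro exterior_ball_imp_frontier[of R l])
    qed
    \<comment> \<open>Freezing \<open>x\<close> outside \<open>{0..L}\<close> gives a 1-Lipschitz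
      function on the whole line.\<close>
    define X where "X s = x (max 0 (min L s))" for s
    have "1-lipschitz_on UNIV X"
    proof (rule lipschitz_onI)
      fix s s' :: real
      have "dist (X s) (X s') \<le> \<bar>max 0 (min L s) - max 0 (min L s')\<bar>"
        unfolding X_def using \<open>0 \<le> L\<close> by (intro lip) auto
      also have "\<dots> \<le> \<bar>s - s'\<bar>"
        by linarith
      finally show "dist (X s) (X s') \<le> 1 * dist s s'"
        by (simp add: dist_real_def)
    qed simp
    then have "AE s in lebesgue. \<exists>v. (X has_vector_derivative v) (at s)"
      by (rule lipschitz_has_vector_derivative_ae)
    \<comment> \<open>The end is removed because the derivative has to be read as a forward
      tangent.\<close>
    moreover have "AE s in lebesgue. s \<notin> {L}"
      by (rule AE_not_in) (simp flip: negligible_iff_null_sets)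
    ultimately have "AE s in lebesgue. s \<in> {0..L} \<longrightarrow>
        (\<exists>v. (x has_vector_derivative v) (at s within {0..L}) \<and> v \<in> normal_cone (\<Omega> s) (x s))"
    proof eventually_elim
      case (elim s)
      show ?case
      proof
        assume s: "s \<in> {0..L}"
        obtain v where "(X has_vector_derivative v) (at s)"
          using elim by blast
        then have "(X has_vector_derivative v) (at s within {0..L})"
          by (rule has_vector_derivative_at_within)
        then have v: "(x has_vector_derivative v) (at s within {0..L})"
          using s by (rule has_vector_derivative_transform[rotated 2]) (auto simp: X_def)
        have "v \<in> normal_cone (\<Omega> s) (x s)"
        \<comment> \<open>The zero vector is in every normal cone; any other \<open>v\<close> is
          normalised to a forward unit tangent and rescaled afterwards.\<close>
        proof (cases "v = 0")
          case True
          then show ?thesis by (simp add: normal_cone_def)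
        next
          case False
          have "v /\<^sub>R norm v \<in> tangent_cone (x ` {s..L}) (x s)"
            using s elim False by (intro vector_derivative_imp_tangent[OF v]) auto
          also have "\<dots> \<subseteq> tangent_cone (g ` {T s..b}) (x s)"
            using future[OF s] by (rule tangent_cone_mono)
          finally have "\<Omega> s \<inter> ball (x s + R *\<^sub>R (v /\<^sub>R norm v)) R = {}"
            using False xT[OF s] by (intro exterior[OF s]) auto
          then have "v /\<^sub>R norm v \<in> normal_cone (\<Omega> s) (x s)"
            using \<open>R > 0\<close> False by (intro exterior_ball_imp_normal) auto
          then have "norm v *\<^sub>R (v /\<^sub>R norm v) \<in> normal_cone (\<Omega> s) (x s)"
            by (rule normal_cone_scaleR) simp
          then show ?thesis
            using False by simp
        qed
        with v show "\<exists>v. (x has_vector_derivative v) (at s within {0..L}) \<and> v \<in> normal_cone (\<Omega> s) (x s)"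
          by blast
      qed
    qed
    then show "AE s in lebesgue_on {0..L}.
        \<exists>v. (x has_vector_derivative v) (at s within {0..L}) \<and> v \<in> normal_cone (\<Omega> s) (x s)"
      by (subst AE_restrict_space_iff) auto
  qed
qed

end
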